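(* Consider $n$ manipulators with dynamics $\mathcal H_i(q_i)\ddot q_i+\mathcal C_i(q_i,\dot q_i)\dot q_i+g_i(q_i)=\tau_i$, $i\in\mathcal V=\{1,\dots,n\}$, $t\ge t_0$, and a leader $\dot x_0=v_0$, $\dot v_0=a_0$ (with $a_0$ continuously differentiable). Suppose Assumptions A1 and A2 hold. Apply the control $$\tau_i=\mathcal H_i(q_i)\ddot q_{ri}+\mathcal C_i(q_i,\dot q_i)\dot q_i+g_i(q_i),$$ $$\ddot q_{ri}=a_i-\varphi\Big(\mathrm{sig}\big(\textstyle\sum_{j\in\mathcal N_i}w_{ij}\bar q_{ij}+p_i\bar q_i\big)^{\alpha_1}\Big)-\psi\Big(\mathrm{sig}\big(\textstyle\sum_{j\in\mathcal N_i}w_{ij}\bar{\dot q}_{ij}+p_i\bar{\dot q}_i\big)^{\alpha_2}\Big),$$ $$\dot a_i=-\beta\,\mathrm{sgn}\Big(\textstyle\sum_{j\in\mathcal N_i}w_{ij}(a_i-a_j)+p_i(a_i-a_0)\Big),$$ where, for $t\in[t_s,t_{s+1})$, $\bar q_{ij}=q_i-q_j-\eta_{si}+\eta_{sj}$, $\bar{\dot q}_{ij}=\dot q_i-\dot q_j$, $\bar q_i=q_i-\eta_{si}-x_0$, $\bar{\dot q}_i=\dot q_i-v_0$. If $0<\alpha_1<1$ and $\alpha_2=2\alpha_1/(\alpha_1+1)$, then time-varying formation tracking is achieved: for arbitrary bounded initial values $q_i(t_0),\dot q_i(t_0),a_i(t_0)$, and assuming the minimum dwell time $\min_s(t_{s+1}-t_s)$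 is large enough, for every $s$ there is a settling time $t_f^s\in[t_s,t_{s+1})$ such that for all $i,j\in\mathcal V$, $$\lim_{t\to t_f^s}\|q_i-q_j-\eta_{si}+\eta_{sj}\|=0,\quad \lim_{t\to t_f^s}\Big\|\tfrac1n\textstyle\sum_{i=1}^n q_i-x_0\Big\|=0,\quad \lim_{t\to t_f^s}\|\dot q_i-v_0\|=0,$$ and these errors remain zero on $[t_f^s,t_{s+1})$.
   Context: $q_i,\dot q_i,\ddot q_i\in\mathbb R^m$; $\mathcal H_i(q_i)\in\mathbb R^{m\times m}$ is the symmetric positive definite inertia matrix, $\mathcal C_i$ the Coriolis/centrifugal matrix, $g_i$ the gravity torque, $\tau_i$ the input torque. Interaction graph: undirected graph on $\mathcal V$ with symmetric adjacency weights $w_{ij}=w_{ji}\ge 0$, $w_{ii}=0$, $w_{ij}>0$ iff $j$ is a neighbour of $i$; $\mathcal N_i$ the neighbour set of $i$. Pinning weights $p_i\ge0$, $p_i>0$ iff manipulator $i$ has access to the leader. Laplacian $\mathcal L$: $l_{ii}=\sum_j w_{ij}$, $l_{ij}=-w_{ij}$ ($i\ne j$). Assumption A1: the leader has a directed path to every node of $\mathcal V$ (via the graph and the pinning weights). Assumption A2: $\sup_{t\ge t_0}\|\dot a_0(t)\|<\beta$ for the positive constant $\beta$ used in the estimator ($\|\cdot\|$ Euclidean norm). Desired formations: a finite set $\{\digamma_0,\dots,\digamma_k\}$, $\digamma_s=\{\eta_{s1},\dots,\eta_{sn}\}$, $\eta_{si}\in\mathbb R^m$, each satisfying $\sum_{i=1}^n\eta_{si}=0$;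 a switching signal with switching times $t_0<t_1<t_2<\cdots$ selects formation $\digamma_s$ on $[t_s,t_{s+1})$. For $z\in\mathbb R^m$ and $\kappa\in\mathbb R$: $\mathrm{sig}(z)^\kappa=\mathrm{col}(|z_1|^\kappa\mathrm{sign}(z_1),\dots,|z_m|^\kappa\mathrm{sign}(z_m))$, $\mathrm{sgn}(z)=\mathrm{col}(\mathrm{sign}(z_1),\dots,\mathrm{sign}(z_m))$. $\varphi,\psi:\mathbb R\to\mathbb R$ are continuous odd functions (applied componentwise to vectors) with $z\varphi(z)>0$, $z\psi(z)>0$ for $z\neq0$, and $\varphi(z)=c_1z+o(z)$, $\psi(z)=c_2z+o(z)$ near $0$ for some constants $c_1,c_2>0$. *)

theory Defs
  imports "HOL-Analysis.Analysis"
begin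

text \<open>Componentwise signed power: sig(z)^kappa.\<close>
definition sig :: "real ^ 'm \<Rightarrow> real \<Rightarrow> real ^ 'm" where
  "sig z \<kappa> = (\<chi> k. \<bar>z $ k\<bar> powr \<kappa> * sgn (z $ k))"

text \<open>Componentwise application of a scalar function.\<close>
definition vmap :: "(real \<Rightarrow> real) \<Rightarrow> real ^ 'm \<Rightarrow> real ^ 'm" where
  "vmap f z = (\<chi> k. f (z $ k))"

text \<open>Filippov regularisation of the scalar sign function: {sign x} for x nonzero,
  the interval [-1,1] at 0.\<close>
definition SGN :: "real \<Rightarrow> real set" where
  "SGN x = (if x > 0 then {1} else if x < 0 then {-1} else {-1..1})"

text \<open>Admissible nonlinearities phi, psi: continuous, odd, z f(z) > 0 for z nonzero,
  f(z) = c z + o(z) near 0 with c > 0.\<close>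
definition admissible_fun :: "(real \<Rightarrow> real) \<Rightarrow> bool" where
  "admissible_fun f \<longleftrightarrow> continuous_on UNIV f \<and> (\<forall>z. f (- z) = - f z)
     \<and> (\<forall>z. z \<noteq> 0 \<longrightarrow> z * f z > 0)
     \<and> (\<exists>c>0. ((\<lambda>z. (f z - c * z) / z) \<longlongrightarrow> 0) (at 0))"

text \<open>Assumption A1: every node is reachable (through edges with positive weight)
  from some node pinned to the leader.\<close>
definition leader_reachable :: "('n \<Rightarrow> 'n \<Rightarrow> real) \<Rightarrow> ('n \<Rightarrow> real) \<Rightarrow> bool" where
  "leader_reachable w p \<longleftrightarrow>
     (\<forall>i. \<exists>j. p j > 0 \<and> (j, i) \<in> {(a, b). w a b > 0}\<^sup>*)"

end

theory Submission
  imports Defs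
begin

text \<open>
  Each coordinate decouples, and the formation errors $e$ and velocity errors $d$ satisfy, with
  $y = M e$, $z = M d$ for the grounded Laplacian $M$ and the estimation error $b$,
  $d' = b - f(y) - h(z)$, where $f$ and $h$ behave like signed powers near $0$.

  The quadratic form of $b$ has a right derivative everywhere: where a component of $M b$ is nonzero
  the sign is locally constant, and where it vanishes the Lipschitz component of $b$ contributes
  nothing. Hence $b$ vanishes in uniform finite time, and a Gronwall estimate bounds $e$ and $d$ until then.

  For $b = 0$ the energy $E = \sum_i \Phi(y_i) + d^T M d / 2$ decreases, but $\Phi$ need not be
  coercive, so $E$ alone does not bound $y$. If at most $m$ components exceed $Y$ in absolute value
  and all stay below $K$, then $X = E - m \Phi(K)$ is at most the energy of the components below $Y$,
  and $X$ is halved from $x$ to $x/2$ in time $C x^\omega$ with $C$ independent of $K$. Summing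
  the geometric series, $E \le m \Phi(K)$ holds after a time $T$ independent of $K$, so
  one may choose $K$ from $T$ and the bound on the speed. Afterwards at most $m - 1$ components
  can exceed $K$. Induction on $m$ gives $E = 0$ in uniform finite time.
\<close>

text \<open>The obstacle is that admissible nonlinearities may decay at infinity:
  \<open>\<Phi>\<close> may be bounded and the restoring force on a distant component arbitrarily
  weak, so no uniform settling time can be read off from the force on such a component. The count of
  large components uses only that \<open>\<Phi>\<close> is nonnegative and strictly increasing in
  the absolute value of its argument. Near the origin the closed loop scales like a homogeneous
  system: at energy level x the natural sizes are x^(1/(1+\<alpha>)) for y, sqrt x for d, and their
  quotient x^\<omega> for time. The prescribed \<open>\<alpha>2\<close> is the exponent for which
  the damping obeys the same scaling, and \<open>\<alpha>1 < 1\<close> makes \<omega> positive,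
  which turns decay into settling in finite time. All constants are uniform over solutions starting
  in a fixed ball, because one dwell time must be named before the switching times and the solution
  are given. Derivatives are one-sided because accelerations may jump at switching times and the
  estimator may slide along surfaces where the sign is set-valued.\<close>

lemma right_derivative_upper_bound:
  fixes f D :: "real \<Rightarrow> real"
  assumes ab: "a \<le> b" and cont: "continuous_on {a..b} f"
    and der: "\<And>t. a \<le> t \<Longrightarrow> t < b \<Longrightarrow> (f has_real_derivative D t) (at t within {t..})"
    and le: "\<And>t. a \<le> t \<Longrightarrow> t < b \<Longrightarrow> D t \<le> c"
  shows "f b \<le> f a + c * (b - a)"
proof -
  have *: "f b \<le> f a + (c + \<epsilon>) * (b - a)" if e: "\<epsilon> > 0" for \<epsilon>
  proof (rule ccontr)
    \<comment> \<open>The slack \<epsilon> makes the right derivative of \<open>g\<close> strictly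
      negative, so \<open>g\<close> cannot rise beyond the last point at which it is
      nonpositive.\<close>
    define g where "g t = f t - f a - (c + \<epsilon>) * (t - a)" for t
    assume "\<not> ?thesis"
    hence gb: "g b > 0" by (simp add: g_def)
    have gcont: "continuous_on {a..b} g" unfolding g_def by (intro continuous_intros cont)
    define A where "A = {t \<in> {a..b}. g t \<le> 0}"
    have aA: "a \<in> A" using ab by (simp add: A_def g_def)
    have "closed A" unfolding A_def
      by (intro continuous_on_closed_Collect_le gcont continuous_intros closed_atLeastAtMost)
    have bdd: "bdd_above A" by (auto simp: A_def intro: bdd_aboveI[of _ b])
    define s where "s = Sup A"
    have sA: "s \<in> A" unfolding s_def using aA bdd \<open>closed A\<close> by (intro closed_contains_Sup) auto
    have "s < b" using sA gb by (cases "s = b") (auto simp: A_def)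
    have "a \<le> s" using sA by (simp add: A_def)
    have "(g has_real_derivative D s - (c + \<epsilon>)) (at s within {s..})"
      unfolding g_def using der[OF \<open>a \<le> s\<close> \<open>s < b\<close>] by (auto intro!: derivative_eq_intros)
    moreover have "D s - (c + \<epsilon>) < 0" using le[OF \<open>a \<le> s\<close> \<open>s < b\<close>] e by simp
    ultimately obtain d where d: "d > 0" "\<And>h. h > 0 \<Longrightarrow> s + h \<in> {s..} \<Longrightarrow> h < d \<Longrightarrow> g (s + h) < g s"
      using has_real_derivative_neg_dec_right by blast
    define h where "h = min (d / 2) (b - s)"
    have h: "h > 0" "h < d" "s + h \<le> b" using d(1) \<open>s < b\<close> by (auto simp: h_def)
    have "g (s + h) < g s" using d(2) h by auto
    hence "s + h \<in> A" using sA h by (auto simp: A_def)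
    hence "s + h \<le> s" unfolding s_def using bdd by (rule cSup_upper)
    thus False using h by simp
  qed
  show ?thesis
  proof (cases "a = b")
    case False
    hence ab': "b - a > 0" using ab by simp
    show ?thesis
    proof (rule field_le_epsilon)
      fix e :: real assume "e > 0"
      have "f b \<le> f a + (c + e / (b - a)) * (b - a)" using *[of "e / (b - a)"] \<open>e > 0\<close> ab' by simp
      also have "\<dots> = f a + c * (b - a) + e" using ab' by (simp add: field_simps)
      finally show "f b \<le> f a + c * (b - a) + e" .
    qed
  qed simp
qed

lemma right_derivative_displacement:
  fixes g :: "real \<Rightarrow> real"
  assumes "a \<le> b" "continuous_on {a..b} g"
    and der: "\<And>t. a \<le> t \<Longrightarrow> t < b \<Longrightarrow> (g has_real_derivative D t) (at t within {t..})"
    and le: "\<And>t. a \<le> t \<Longrightarrow> t < b \<Longrightarrow> \<bar>D t\<bar> \<le> Z"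
  shows "\<bar>g b\<bar> \<le> \<bar>g a\<bar> + Z * (b - a)"
proof -
  have "g b \<le> g a + Z * (b - a)"
    using le by (intro right_derivative_upper_bound[OF assms(1,2) der]) (auto simp: abs_le_iff)
  moreover have "- g b \<le> - g a + Z * (b - a)"
    using le assms(2) by (intro right_derivative_upper_bound[OF assms(1) _ DERIV_minus[OF der]] continuous_intros)
       (auto simp: abs_le_iff)
  ultimately show ?thesis by linarith
qed

section \<open>The grounded Laplacian\<close>

definition lap :: "('n::finite \<Rightarrow> 'n \<Rightarrow> real) \<Rightarrow> ('n \<Rightarrow> real) \<Rightarrow> ('n \<Rightarrow> real) \<Rightarrow> 'n \<Rightarrow> real" where
  "lap w p x i = (\<Sum>j\<in>UNIV. w i j * (x i - x j)) + p i * x i"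

definition dform :: "('n::finite \<Rightarrow> 'n \<Rightarrow> real) \<Rightarrow> ('n \<Rightarrow> real) \<Rightarrow> ('n \<Rightarrow> real) \<Rightarrow> real" where
  "dform w p x = (\<Sum>i\<in>UNIV. x i * lap w p x i)"

lemma has_derivative_lap:
  assumes "\<And>j. (e j has_real_derivative d j) (at t within S)"
  shows "((\<lambda>t. lap w p (\<lambda>j. e j t) i) has_real_derivative lap w p d i) (at t within S)"
  unfolding lap_def
  by (intro DERIV_add DERIV_sum DERIV_cmult DERIV_diff assms)

lemma continuous_on_lap:
  assumes "\<And>j. continuous_on S (e j)"
  shows "continuous_on S (\<lambda>t. lap w p (\<lambda>j. e j t) i)"
  unfolding lap_def by (intro continuous_intros assms)

lemma lap_abs_bound:
  fixes w :: "'n::finite \<Rightarrow> 'n \<Rightarrow> real"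
  shows "\<exists>C>0. \<forall>x D i. (\<forall>j. \<bar>x j\<bar> \<le> D) \<longrightarrow> \<bar>lap w p x i\<bar> \<le> C * D"
proof -
  \<comment> \<open>The sum over all rows dominates each single row, and \<open>+ 1\<close> keeps
    \<open>C\<close> positive even if all weights vanish.\<close>
  define C where "C = (\<Sum>i\<in>UNIV. (\<Sum>j\<in>UNIV. 2 * \<bar>w i j\<bar>) + \<bar>p i\<bar>) + 1"
  have "C > 0" unfolding C_def by (intro add_nonneg_pos sum_nonneg add_nonneg_nonneg) auto
  moreover have "\<bar>lap w p x i\<bar> \<le> C * D" if x: "\<And>j. \<bar>x j\<bar> \<le> D" for x D i
  proof -
    have D: "D \<ge> 0" using x[of i] by linarith
    have "\<bar>lap w p x i\<bar> \<le> (\<Sum>j\<in>UNIV. \<bar>w i j * (x i - x j)\<bar>) + \<bar>p i * x i\<bar>"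
      unfolding lap_def by (rule order_trans[OF abs_triangle_ineq]) (intro add_mono sum_abs order_refl)
    also have "\<dots> \<le> (\<Sum>j\<in>UNIV. 2 * \<bar>w i j\<bar> * D) + \<bar>p i\<bar> * D"
    proof (intro add_mono sum_mono)
      fix j
      have "\<bar>x i - x j\<bar> \<le> 2 * D" using x[of i] x[of j] by linarith
      thus "\<bar>w i j * (x i - x j)\<bar> \<le> 2 * \<bar>w i j\<bar> * D"
        using mult_left_mono[of "\<bar>x i - x j\<bar>" "2 * D" "\<bar>w i j\<bar>"] by (simp add: abs_mult mult_ac)
    qed (auto simp: abs_mult intro: mult_left_mono x)
    also have "\<dots> = ((\<Sum>j\<in>UNIV. 2 * \<bar>w i j\<bar>) + \<bar>p i\<bar>) * D"
      by (simp add: sum_distrib_right distrib_right)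
    also have "\<dots> \<le> C * D"
    proof (rule mult_right_mono[OF _ D])
      have "(\<Sum>j\<in>UNIV. 2 * \<bar>w i j\<bar>) + \<bar>p i\<bar> \<le> (\<Sum>i\<in>UNIV. (\<Sum>j\<in>UNIV. 2 * \<bar>w i j\<bar>) + \<bar>p i\<bar>)"
        by (rule member_le_sum) (auto intro!: add_nonneg_nonneg sum_nonneg)
      thus "(\<Sum>j\<in>UNIV. 2 * \<bar>w i j\<bar>) + \<bar>p i\<bar> \<le> C" by (simp add: C_def)
    qed
    finally show ?thesis .
  qed
  ultimately show ?thesis by blast
qed

locale pinned_graph =
  fixes w :: "'n::finite \<Rightarrow> 'n \<Rightarrow> real" and p :: "'n \<Rightarrow> real"
  assumes w_sym: "w i j = w j i"
    and w_nonneg: "w i j \<ge> 0"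
    and p_nonneg: "p i \<ge> 0"
    and reachable: "leader_reachable w p"
begin

lemma lap_self_adjoint: "(\<Sum>i\<in>UNIV. x i * lap w p y i) = (\<Sum>i\<in>UNIV. y i * lap w p x i)"
proof -
  have "(\<Sum>i\<in>UNIV. x i * lap w p y i) =
     (\<Sum>i\<in>UNIV. \<Sum>j\<in>UNIV. w i j * x i * y i) - (\<Sum>i\<in>UNIV. \<Sum>j\<in>UNIV. w i j * x i * y j)
     + (\<Sum>i\<in>UNIV. p i * x i * y i)" for x y
    unfolding lap_def
    by (simp add: sum.distrib sum_subtractf sum_distrib_left algebra_simps)
  note E = this
  have "(\<Sum>i\<in>UNIV. \<Sum>j\<in>UNIV. w i j * x i * y j) = (\<Sum>i\<in>UNIV. \<Sum>j\<in>UNIV. w i j * y i * x j)"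
    by (subst sum.swap) (intro sum.cong refl, metis w_sym mult.assoc mult.commute)
  thus ?thesis unfolding E by (simp add: mult_ac)
qed

lemma dform_eq:
  "dform w p x = (\<Sum>i\<in>UNIV. \<Sum>j\<in>UNIV. w i j * (x i - x j)\<^sup>2) / 2 + (\<Sum>i\<in>UNIV. p i * (x i)\<^sup>2)"
proof -
  have 1: "(\<Sum>i\<in>UNIV. \<Sum>j\<in>UNIV. w i j * (x j)\<^sup>2) = (\<Sum>i\<in>UNIV. \<Sum>j\<in>UNIV. w i j * (x i)\<^sup>2)"
    by (subst sum.swap) (intro sum.cong refl, metis w_sym)
  have "(\<Sum>i\<in>UNIV. \<Sum>j\<in>UNIV. w i j * (x i - x j)\<^sup>2)
      = (\<Sum>i\<in>UNIV. \<Sum>j\<in>UNIV. w i j * (x i)\<^sup>2) + (\<Sum>i\<in>UNIV. \<Sum>j\<in>UNIV. w i j * (x j)\<^sup>2)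
        - (\<Sum>i\<in>UNIV. \<Sum>j\<in>UNIV. 2 * (w i j * x i * x j))"
    by (simp add: power2_diff algebra_simps sum.distrib sum_subtractf)
  also have "\<dots> = 2 * (\<Sum>i\<in>UNIV. \<Sum>j\<in>UNIV. w i j * x i * (x i - x j))"
    unfolding 1 by (simp add: power2_eq_square algebra_simps sum.distrib sum_subtractf sum_distrib_left)
  finally show ?thesis
    unfolding dform_def lap_def
    by (simp add: power2_eq_square sum.distrib sum_distrib_left algebra_simps)
qed

lemma edge_le_dform: "w i j * (x i - x j)\<^sup>2 \<le> 2 * dform w p x"
proof -
  have "w i j * (x i - x j)\<^sup>2 \<le> (\<Sum>j\<in>UNIV. w i j * (x i - x j)\<^sup>2)"
    using w_nonneg by (intro member_le_sum) auto
  also have "\<dots> \<le> (\<Sum>i\<in>UNIV. \<Sum>j\<in>UNIV. w i j * (x i - x j)\<^sup>2)"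
    using w_nonneg by (intro member_le_sum[of i UNIV "\<lambda>i. \<Sum>j\<in>UNIV. w i j * (x i - x j)\<^sup>2"]) (auto intro!: sum_nonneg)
  also have "\<dots> \<le> 2 * dform w p x"
    unfolding dform_eq using p_nonneg by (simp add: sum_nonneg)
  finally show ?thesis .
qed

lemma pin_le_dform: "p i * (x i)\<^sup>2 \<le> dform w p x"
proof -
  have "p i * (x i)\<^sup>2 \<le> (\<Sum>i\<in>UNIV. p i * (x i)\<^sup>2)"
    using p_nonneg by (intro member_le_sum) auto
  also have "\<dots> \<le> dform w p x"
    unfolding dform_eq using w_nonneg by (simp add: sum_nonneg)
  finally show ?thesis .
qed

lemma dform_nonneg: "dform w p x \<ge> 0"
  unfolding dform_eq using p_nonneg w_nonneg by (simp add: sum_nonneg)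

text \<open>Quantitative positive definiteness of the grounded Laplacian, and the point where
  reachability of the leader enters. A pinned node is controlled by its pinning term, and each edge
  on a path from it passes the control on at the price of a larger constant.\<close>

lemma coordinate_le_dform: "\<exists>C>0. \<forall>x i. (x i)\<^sup>2 \<le> C * dform w p x"
proof -
  have node: "\<exists>C>0. \<forall>x. (x i)\<^sup>2 \<le> C * dform w p x" for i
  proof -
    obtain j where pj: "p j > 0" and path: "(j, i) \<in> {(a, b). w a b > 0}\<^sup>*"
      using reachable unfolding leader_reachable_def by blast
    from path show ?thesis
    proof (induction rule: rtrancl_induct)
      case base
      have "(x j)\<^sup>2 \<le> inverse (p j) * dform w p x" for x
        using pin_le_dform[of j x] pj by (simp add: field_simps)
      thus ?case using pj by (intro exI[of _ "inverse (p j)"]) auto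
    next
      case (step a b)
      then obtain C where C: "C > 0" "\<And>x. (x a)\<^sup>2 \<le> C * dform w p x" by blast
      have w: "w a b > 0" using step by simp
      have "(x b)\<^sup>2 \<le> (2 * C + 4 / w a b) * dform w p x" for x
      proof -
        have "(x a - x b)\<^sup>2 \<le> 2 / w a b * dform w p x"
          using edge_le_dform[of a b x] w by (simp add: field_simps)
        moreover have "(x b)\<^sup>2 \<le> 2 * (x a)\<^sup>2 + 2 * (x a - x b)\<^sup>2"
          using zero_le_power2[of "2 * x a - x b"] by (simp add: power2_eq_square algebra_simps)
        ultimately show ?thesis using C(2)[of x] by (simp add: algebra_simps)
      qed
      moreover have "2 * C + 4 / w a b > 0" using C(1) w by (intro add_pos_pos) auto
      ultimately show ?case by blast
    qed
  qed
  then obtain C where C: "\<And>i. C i > 0" "\<And>i x. (x i)\<^sup>2 \<le> C i * dform w p x" by metis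
  have "C i \<le> (\<Sum>i\<in>UNIV. C i)" for i using C(1) by (intro member_le_sum) (auto intro: less_imp_le)
  hence "(x i)\<^sup>2 \<le> (\<Sum>i\<in>UNIV. C i) * dform w p x" for x i
    using C(2)[of x i] dform_nonneg[of x] by (meson mult_right_mono order_trans)
  moreover have "(\<Sum>i\<in>UNIV. C i) > 0" using C(1) by (intro sum_pos) auto
  ultimately show ?thesis by blast
qed

text \<open>Young's inequality is applied to each product \<open>x i * lap w p x i\<close>, and the
  part in \<open>x i\<close> is absorbed into the left-hand side by positive definiteness.\<close>

lemma dform_le_lap: "\<exists>C>0. \<forall>x. dform w p x \<le> C * (\<Sum>i\<in>UNIV. (lap w p x i)\<^sup>2)"
proof -
  obtain C where C: "C > 0" "\<And>x i. (x i)\<^sup>2 \<le> C * dform w p x" using coordinate_le_dform by blast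
  define n where "n = real CARD('n)"
  have n: "n > 0" by (simp add: n_def)
  \<comment> \<open>This weight in Young's inequality makes the n terms in
    \<open>(x i)\<^sup>2\<close> add up to at most half of \<open>dform w p x\<close>.\<close>
  define K where "K = n * C"
  have K: "K > 0" using n C by (simp add: K_def)
  have "dform w p x \<le> K * (\<Sum>i\<in>UNIV. (lap w p x i)\<^sup>2)" for x
  proof -
    have "dform w p x \<le> (\<Sum>i\<in>UNIV. dform w p x / (2 * n) + K / 2 * (lap w p x i)\<^sup>2)"
    proof -
      have "x i * lap w p x i \<le> dform w p x / (2 * n) + K / 2 * (lap w p x i)\<^sup>2" for i
      proof -
        have "2 * K * (x i * lap w p x i) \<le> (x i)\<^sup>2 + K\<^sup>2 * (lap w p x i)\<^sup>2"
          using zero_le_power2[of "x i - K * lap w p x i"] by (simp add: power2_eq_square algebra_simps)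
        also have "\<dots> \<le> C * dform w p x + K\<^sup>2 * (lap w p x i)\<^sup>2" using C(2)[of x i] by simp
        also have "\<dots> = 2 * K * (dform w p x / (2 * n) + K / 2 * (lap w p x i)\<^sup>2)"
          using n by (simp add: K_def power2_eq_square field_simps)
        finally show ?thesis using K by simp
      qed
      thus "dform w p x \<le> (\<Sum>i\<in>UNIV. dform w p x / (2 * n) + K / 2 * (lap w p x i)\<^sup>2)"
        by (subst dform_def) (rule sum_mono)
    qed
    also have "\<dots> = dform w p x / 2 + K / 2 * (\<Sum>i\<in>UNIV. (lap w p x i)\<^sup>2)"
      using n by (simp add: sum.distrib sum_distrib_left n_def)
    finally show ?thesis by simp
  qed
  thus ?thesis using K by blast
qed

end

section \<open>Nonlinearities behaving like signed powers near the origin\<close>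

text \<open>The comparison with a power is demanded on bounded sets only, with constants depending
  on \<open>Y\<close>: for large arguments \<open>f\<close> may decay or grow at any rate.\<close>

definition power_like :: "(real \<Rightarrow> real) \<Rightarrow> real \<Rightarrow> bool" where
  "power_like f \<alpha> \<longleftrightarrow> continuous_on UNIV f \<and> (\<forall>y. f (- y) = - f y) \<and> (\<forall>y. y \<noteq> 0 \<longrightarrow> y * f y > 0)
     \<and> (\<forall>Y. \<exists>c>0. \<exists>C>0. \<forall>y. \<bar>y\<bar> \<le> Y \<longrightarrow> c * \<bar>y\<bar> powr \<alpha> \<le> \<bar>f y\<bar> \<and> \<bar>f y\<bar> \<le> C * \<bar>y\<bar> powr \<alpha>)"

text \<open>Near 0 the bounds come from the positive slope of \<phi> at the origin, away from 0 from
  the extreme values of \<open>\<phi> u / u\<close> on a compact interval; oddness covers negative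
  arguments.\<close>

lemma admissible_fun_linear_bounds:
  assumes "admissible_fun \<phi>"
  shows "\<exists>c>0. \<exists>C>0. \<forall>u. \<bar>u\<bar> \<le> U \<longrightarrow> c * \<bar>u\<bar> \<le> \<bar>\<phi> u\<bar> \<and> \<bar>\<phi> u\<bar> \<le> C * \<bar>u\<bar>"
proof -
  from assms obtain k where cont: "continuous_on UNIV \<phi>" and odd: "\<And>z. \<phi> (- z) = - \<phi> z"
    and pos: "\<And>z. z \<noteq> 0 \<Longrightarrow> z * \<phi> z > 0" and k: "k > 0"
    and lim: "((\<lambda>z. (\<phi> z - k * z) / z) \<longlongrightarrow> 0) (at 0)"
    unfolding admissible_fun_def by blast
  have "k / 2 > 0" using k by simp
  from LIM_D[OF lim this] obtain \<delta> where
    d: "\<delta> > 0" "\<And>z. z \<noteq> 0 \<Longrightarrow> \<bar>z\<bar> < \<delta> \<Longrightarrow> \<bar>(\<phi> z - k * z) / z\<bar> < k / 2"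
    by auto
  have small: "k / 2 * \<bar>u\<bar> \<le> \<bar>\<phi> u\<bar> \<and> \<bar>\<phi> u\<bar> \<le> 3 * k / 2 * \<bar>u\<bar>" if u: "u \<noteq> 0" "\<bar>u\<bar> < \<delta>" for u
  proof -
    have "\<bar>\<phi> u - k * u\<bar> \<le> k / 2 * \<bar>u\<bar>" using d(2)[OF u] u(1) by (simp add: abs_divide field_simps)
    moreover have "\<bar>k * u\<bar> = k * \<bar>u\<bar>" using k by (simp add: abs_mult)
    ultimately show ?thesis by linarith
  qed
  \<comment> \<open>The maximum keeps \<open>{\<delta>..W}\<close> nonempty when \<open>U\<close> is
    smaller than \<delta>.\<close>
  define W where "W = max U \<delta>"
  have W: "\<delta> \<le> W" "U \<le> W" by (auto simp: W_def)
  have ne: "{\<delta>..W} \<noteq> {}" using W by simp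
  have c1: "continuous_on {\<delta>..W} (\<lambda>u. \<phi> u / u)"
    using d(1) by (intro continuous_intros continuous_on_subset[OF cont]) auto
  obtain um where um: "um \<in> {\<delta>..W}" "\<And>u. u \<in> {\<delta>..W} \<Longrightarrow> \<phi> um / um \<le> \<phi> u / u"
    using continuous_attains_inf[OF compact_Icc ne c1] by blast
  obtain uM where uM: "uM \<in> {\<delta>..W}" "\<And>u. u \<in> {\<delta>..W} \<Longrightarrow> \<phi> u / u \<le> \<phi> uM / uM"
    using continuous_attains_sup[OF compact_Icc ne c1] by blast
  have pos': "\<phi> u > 0" if "u > 0" for u using pos[of u] that by (simp add: zero_less_mult_iff)
  have mpos: "\<phi> um / um > 0" using um(1) d(1) pos'[of um] by auto
  define c where "c = min (k / 2) (\<phi> um / um)"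
  define C where "C = max (3 * k / 2) (\<phi> uM / uM)"
  have c: "c > 0" using k mpos by (simp add: c_def)
  have C: "C > 0" using k by (simp add: C_def less_max_iff_disj)
  have main: "c * u \<le> \<phi> u \<and> \<phi> u \<le> C * u" if u: "u > 0" "u \<le> U" for u
  proof (cases "u < \<delta>")
    case True
    have "c \<le> k / 2" "3 * k / 2 \<le> C"
      unfolding c_def C_def by (rule min.cobounded1, rule max.cobounded1)
    hence "c * u \<le> k / 2 * u" "3 * k / 2 * u \<le> C * u"
      using u by (auto intro: mult_right_mono simp del: times_divide_eq_left)
    moreover have "\<bar>u\<bar> = u" "\<bar>\<phi> u\<bar> = \<phi> u" using u pos'[of u] by auto
    moreover have "k / 2 * \<bar>u\<bar> \<le> \<bar>\<phi> u\<bar>" "\<bar>\<phi> u\<bar> \<le> 3 * k / 2 * \<bar>u\<bar>"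
      using small[of u] True u by auto
    ultimately show ?thesis by simp
  next
    case False
    hence uI: "u \<in> {\<delta>..W}" using u W by auto
    have "c * u \<le> \<phi> um / um * u" "\<phi> uM / uM * u \<le> C * u"
      unfolding c_def C_def using u by (auto intro!: mult_right_mono simp del: times_divide_eq_left)
    moreover have "\<phi> um / um * u \<le> \<phi> u" "\<phi> u \<le> \<phi> uM / uM * u"
      using um(2)[OF uI] uM(2)[OF uI] u(1) by (simp_all add: pos_le_divide_eq pos_divide_le_eq)
    ultimately show ?thesis by linarith
  qed
  have "c * \<bar>u\<bar> \<le> \<bar>\<phi> u\<bar> \<and> \<bar>\<phi> u\<bar> \<le> C * \<bar>u\<bar>" if u: "\<bar>u\<bar> \<le> U" for u
  proof -
    consider "u = 0" | "u > 0" | "u < 0" by linarith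
    thus ?thesis
    proof cases
      case 1
      have "\<phi> 0 = 0" using odd[of 0] by simp
      thus ?thesis using 1 by simp
    next
      case 2
      thus ?thesis using main[of u] u pos'[of u] by auto
    next
      case 3
      thus ?thesis using main[of "- u"] u pos'[of "- u"] odd[of u] by auto
    qed
  qed
  thus ?thesis using c C by blast
qed

lemma power_like_admissible_sig:
  assumes "admissible_fun \<phi>" "\<alpha> > 0"
  shows "power_like (\<lambda>y. \<phi> (\<bar>y\<bar> powr \<alpha> * sgn y)) \<alpha>"
proof -
  define s where "s y = \<bar>y\<bar> powr \<alpha> * sgn y" for y :: real
  have cont: "continuous_on UNIV \<phi>" and odd: "\<And>z. \<phi> (- z) = - \<phi> z"
    and pos: "\<And>z. z \<noteq> 0 \<Longrightarrow> z * \<phi> z > 0"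
    using assms(1) unfolding admissible_fun_def by auto
  have abs_s: "\<bar>s y\<bar> = \<bar>y\<bar> powr \<alpha>" for y by (simp add: s_def abs_mult sgn_if)
  \<comment> \<open>As a difference of powers of the positive and the negative part, the signed
    power is visibly continuous at 0, which the form with \<open>sgn\<close> hides.\<close>
  have s_eq: "s y = (max y 0) powr \<alpha> - (max (- y) 0) powr \<alpha>" for y
    by (auto simp: s_def sgn_if max_def)
  have "continuous_on UNIV s"
    unfolding s_eq[abs_def] using assms(2) by (intro continuous_intros continuous_on_powr') auto
  hence "continuous_on UNIV (\<lambda>y. \<phi> (s y))"
    by (rule continuous_on_compose2[OF cont]) auto
  moreover have "\<phi> (s (- y)) = - \<phi> (s y)" for y
    using odd[of "s y"] by (simp add: s_def)
  moreover have "y * \<phi> (s y) > 0" if "y \<noteq> 0" for y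
  proof -
    have "s y \<noteq> 0" using that abs_s[of y] by auto
    hence "s y * \<phi> (s y) > 0" by (rule pos)
    moreover have "s y * \<phi> (s y) = \<bar>y\<bar> powr \<alpha> * (sgn y * \<phi> (s y))" by (simp add: s_def)
    ultimately have "sgn y * \<phi> (s y) > 0" by (simp add: zero_less_mult_iff)
    thus ?thesis using that by (auto simp: sgn_if zero_less_mult_iff split: if_splits)
  qed
  moreover have "\<exists>c>0. \<exists>C>0. \<forall>y. \<bar>y\<bar> \<le> Y \<longrightarrow> c * \<bar>y\<bar> powr \<alpha> \<le> \<bar>\<phi> (s y)\<bar> \<and> \<bar>\<phi> (s y)\<bar> \<le> C * \<bar>y\<bar> powr \<alpha>" for Y
  proof -
    obtain c C where cC: "c > 0" "C > 0" "\<And>u. \<bar>u\<bar> \<le> Y powr \<alpha> \<Longrightarrow> c * \<bar>u\<bar> \<le> \<bar>\<phi> u\<bar> \<and> \<bar>\<phi> u\<bar> \<le> C * \<bar>u\<bar>"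
      using admissible_fun_linear_bounds[OF assms(1), of "Y powr \<alpha>"] by blast
    have "c * \<bar>y\<bar> powr \<alpha> \<le> \<bar>\<phi> (s y)\<bar> \<and> \<bar>\<phi> (s y)\<bar> \<le> C * \<bar>y\<bar> powr \<alpha>" if "\<bar>y\<bar> \<le> Y" for y
      using cC(3)[of "s y"] that assms(2) unfolding abs_s by (simp add: powr_mono2)
    thus ?thesis using cC(1,2) by blast
  qed
  ultimately show ?thesis unfolding power_like_def s_def by blast
qed

lemma ex_antiderivative:
  fixes f :: "real \<Rightarrow> real"
  assumes "continuous_on UNIV f"
  shows "\<exists>F. F 0 = 0 \<and> (\<forall>y. (F has_real_derivative f y) (at y))"
proof -
  obtain F where F: "\<And>y. (F has_vector_derivative f y) (at y)"
    using einterval_antiderivative[of "-\<infinity>" "\<infinity>" f] assms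
    by (auto simp: continuous_on_eq_continuous_at)
  have "((\<lambda>y. F y - F 0) has_real_derivative f y) (at y)" for y
    using F[of y] by (auto simp: has_real_derivative_iff_has_vector_derivative[symmetric] intro!: derivative_eq_intros)
  thus ?thesis by (intro exI[of _ "\<lambda>y. F y - F 0"]) auto
qed

text \<open>Below a threshold both lower powers together stay under \<open>c\<close>; above it each
  is dominated by a multiple of the top power. This later lets the damping pay for the cross
  terms.\<close>

lemma lower_powers_absorbed:
  fixes A B c \<alpha> :: real
  assumes "A \<ge> 0" "B \<ge> 0" "c > 0" "\<alpha> > 0" "\<alpha> < 1"
  shows "\<exists>K>0. \<forall>u\<ge>0. A * u + B * u powr \<alpha> \<le> K * u powr (1 + \<alpha>) + c"
proof -
  \<comment> \<open>\<open>r\<close> is small enough for (A + B) r \<le> c, and \<delta> is the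
    point whose power \<alpha> equals \<open>r\<close>. As \<open>r \<le> 1\<close> and
    \<open>\<alpha> < 1\<close>, also \<open>\<delta> \<le> r\<close>, so one threshold serves both
    powers.\<close>
  define r where "r = min 1 (c / (A + B + 1))"
  define \<delta> where "\<delta> = r powr (1 / \<alpha>)"
  have r: "r > 0" "r \<le> 1" using assms by (auto simp: r_def)
  have d: "\<delta> > 0" using r by (simp add: \<delta>_def)
  have da: "\<delta> powr \<alpha> = r" using r assms by (simp add: \<delta>_def powr_powr)
  have "\<delta> \<le> 1" unfolding \<delta>_def using r assms powr_mono2[of "1/\<alpha>" r 1] by simp
  hence "\<delta> powr 1 \<le> \<delta> powr \<alpha>" using d assms by (intro powr_mono') auto
  hence dr: "\<delta> \<le> r" using d da by simp
  have rc: "(A + B) * r \<le> c"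
  proof -
    have "(A + B) * r \<le> (A + B + 1) * (c / (A + B + 1))"
      using assms r by (intro mult_mono) (auto simp: r_def)
    thus ?thesis using assms by simp
  qed
  define K where "K = A / r + B / \<delta> + 1"
  have K: "K > 0" using assms r d by (simp add: K_def add_nonneg_pos)
  have "A * u + B * u powr \<alpha> \<le> K * u powr (1 + \<alpha>) + c" if u: "u \<ge> 0" for u
  proof (cases "u \<le> \<delta>")
    case True
    have "u powr \<alpha> \<le> r" using True u assms da powr_mono2[of \<alpha> u \<delta>] by simp
    hence "A * u + B * u powr \<alpha> \<le> A * r + B * r"
      using True dr assms by (intro add_mono mult_left_mono) auto
    also have "\<dots> \<le> c" using rc by (simp add: algebra_simps)
    finally show ?thesis using K by (smt (verit) mult_nonneg_nonneg powr_ge_zero)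
  next
    case False
    hence u0: "u > 0" using d by simp
    have ua: "u powr (1 + \<alpha>) = u * u powr \<alpha>" using u0 by (simp add: powr_add)
    have "r \<le> u powr \<alpha>" using False d assms da powr_mono2[of \<alpha> \<delta> u] by simp
    hence "A * u * 1 \<le> A * u * (u powr \<alpha> / r)" using assms u0 r by (intro mult_left_mono) auto
    moreover have "B * u powr \<alpha> * 1 \<le> B * u powr \<alpha> * (u / \<delta>)"
      using assms False d by (intro mult_left_mono) auto
    ultimately have "A * u + B * u powr \<alpha> \<le> A * u * (u powr \<alpha> / r) + B * u powr \<alpha> * (u / \<delta>)" by simp
    also have "\<dots> = (A / r + B / \<delta>) * u powr (1 + \<alpha>)" unfolding ua by (simp add: field_simps)
    also have "\<dots> \<le> K * u powr (1 + \<alpha>)" by (intro mult_right_mono) (auto simp: K_def)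
    finally show ?thesis using assms by simp
  qed
  thus ?thesis using K by blast
qed

lemma arctan_abs_le_2: "\<bar>arctan (x :: real)\<bar> \<le> 2"
  using arctan_bounded[of x] pi_half_less_two by linarith

section \<open>Energy decay of the formation errors\<close>

locale error_dynamics = pinned_graph w p for w :: "'n::finite \<Rightarrow> 'n \<Rightarrow> real" and p +
  fixes f h \<Phi> :: "real \<Rightarrow> real" and \<alpha> :: real
  assumes alpha: "0 < \<alpha>" "\<alpha> < 1"
    and f_power: "power_like f \<alpha>"
    and h_power: "power_like h (2 * \<alpha> / (\<alpha> + 1))"
    and potential: "(\<Phi> has_real_derivative f y) (at y)"
    and potential_0: "\<Phi> 0 = 0"
begin

lemma f_odd: "f (- y) = - f y"
  and f_pos: "y \<noteq> 0 \<Longrightarrow> y * f y > 0" and h_pos: "y \<noteq> 0 \<Longrightarrow> y * h y > 0"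
  using f_power h_power unfolding power_like_def by auto

lemma f_nonneg: "y * f y \<ge> 0" and h_nonneg: "y * h y \<ge> 0"
  using f_pos[of y] h_pos[of y] by (cases "y = 0", auto)+

lemma potential_even: "\<Phi> (- y) = \<Phi> y"
proof -
  have "((\<lambda>y. \<Phi> (- y) - \<Phi> y) has_real_derivative 0) (at x)" for x
  proof -
    have "((\<lambda>y. \<Phi> (- y)) has_real_derivative f (- x) * (-1)) (at x)"
      by (rule DERIV_chain2[OF potential]) (auto intro!: derivative_eq_intros)
    thus ?thesis using potential[of x] f_odd[of x] by (auto intro!: derivative_eq_intros)
  qed
  hence "(\<lambda>y. \<Phi> (- y) - \<Phi> y) y = (\<lambda>y. \<Phi> (- y) - \<Phi> y) 0"
    using DERIV_const_ratio_const2 DERIV_isconst_all by blast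
  thus ?thesis by simp
qed

text \<open>Strictness matters twice: it yields the contradiction when too many components lie
  beyond a threshold, and it makes 0 the only zero of \<Phi>. Neither use needs \<Phi> to be
  unbounded.\<close>

lemma potential_strict_mono: "\<bar>x\<bar> < \<bar>y\<bar> \<Longrightarrow> \<Phi> x < \<Phi> y"
proof -
  assume xy: "\<bar>x\<bar> < \<bar>y\<bar>"
  have "\<Phi> \<bar>x\<bar> < \<Phi> \<bar>y\<bar>"
  proof (rule DERIV_pos_imp_increasing_open[OF xy])
    show "\<exists>l. (\<Phi> has_real_derivative l) (at z) \<and> 0 < l" if "\<bar>x\<bar> < z" "z < \<bar>y\<bar>" for z
    proof (intro exI[of _ "f z"] conjI potential)
      have "z > 0" using that by linarith
      thus "0 < f z" using f_pos[of z] by (simp add: zero_less_mult_iff)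
    qed
    show "continuous_on {\<bar>x\<bar>..\<bar>y\<bar>} \<Phi>" using potential by (meson DERIV_continuous_on has_field_derivative_at_within)
  qed
  moreover have "\<Phi> \<bar>z\<bar> = \<Phi> z" for z using potential_even[of z] by (simp add: abs_if)
  ultimately show ?thesis by simp
qed

lemma potential_mono: "\<bar>x\<bar> \<le> \<bar>y\<bar> \<Longrightarrow> \<Phi> x \<le> \<Phi> y"
proof -
  assume "\<bar>x\<bar> \<le> \<bar>y\<bar>"
  then consider "\<bar>x\<bar> < \<bar>y\<bar>" | "x = y" | "x = - y" by linarith
  thus ?thesis by cases (auto simp: potential_even intro: less_imp_le potential_strict_mono)
qed

lemma potential_nonneg: "\<Phi> y \<ge> 0" using potential_mono[of 0 y] potential_0 by simp

lemma potential_le_power: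
  assumes C: "\<And>y. \<bar>y\<bar> \<le> Y \<Longrightarrow> \<bar>f y\<bar> \<le> C * \<bar>y\<bar> powr \<alpha>" and y: "\<bar>y\<bar> \<le> Y" and C0: "C > 0"
  shows "\<Phi> y \<le> C * \<bar>y\<bar> powr (1 + \<alpha>)"
proof (cases "y = 0")
  case False
  hence pos: "0 < \<bar>y\<bar>" by simp
  obtain z where z: "0 < z" "z < \<bar>y\<bar>" "\<Phi> \<bar>y\<bar> - \<Phi> 0 = (\<bar>y\<bar> - 0) * f z"
    using MVT2[OF pos, of \<Phi> f] potential by blast
  have "f z \<le> C * z powr \<alpha>" using C[of z] z y by auto
  also have "\<dots> \<le> C * \<bar>y\<bar> powr \<alpha>" using z alpha C0 by (intro mult_left_mono powr_mono2) auto
  finally have "\<Phi> \<bar>y\<bar> \<le> \<bar>y\<bar> * (C * \<bar>y\<bar> powr \<alpha>)" using z potential_0 pos by (simp add: mult_left_mono)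
  moreover have "\<Phi> \<bar>y\<bar> = \<Phi> y" using potential_even[of y] by (simp add: abs_if)
  ultimately show ?thesis using pos by (simp add: powr_add mult_ac)
qed (simp add: potential_0)

text \<open>The exponent is 1/(1+\<alpha>) - 1/2: x^\<omega> is the time in which a speed of size
  sqrt x covers the distance x^(1/(1+\<alpha>)). It is positive since
  \<open>\<alpha> < 1\<close>.\<close>

abbreviation \<omega> :: real where "\<omega> \<equiv> (1 - \<alpha>) / (2 * (1 + \<alpha>))"

text \<open>The left-hand side is the time derivative of
  $\sum_i L \arctan(y_i/L) \, S \arctan(d_i/S) + \mu x^\omega E$, where $L = x^{1/(1+\alpha)}$ and $S = \sqrt x$
  are the homogeneous scales of $y$ and $d$ at energy level $x$. Saturating both factors at these
  scales is what allows components of $y$ and $z$ far above the level $x$.\<close>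
lemma virtual_dissipation:
  "\<exists>\<mu>>0. \<exists>\<epsilon>>0. \<forall>x y d. x > 0 \<longrightarrow> (\<forall>i. \<bar>lap w p d i\<bar> \<le> Z) \<longrightarrow>
    x / 2 \<le> dform w p d / 2 + (\<Sum>i | \<bar>y i\<bar> \<le> Y. \<Phi> (y i)) \<longrightarrow>
    (\<Sum>i\<in>UNIV. lap w p d i / (1 + (y i / x powr (1 / (1 + \<alpha>)))\<^sup>2) * (sqrt x * arctan (d i / sqrt x))
        - x powr (1 / (1 + \<alpha>)) * arctan (y i / x powr (1 / (1 + \<alpha>)))
          * ((f (y i) + h (lap w p d i)) / (1 + (d i / sqrt x)\<^sup>2)))
      - \<mu> * x powr \<omega> * (\<Sum>i\<in>UNIV. lap w p d i * h (lap w p d i)) \<le> - \<epsilon> * x"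
proof -
  define a2 where "a2 = 2 * \<alpha> / (\<alpha> + 1)"
  have a2: "0 < a2" "a2 < 1" using alpha by (auto simp: a2_def field_simps)
  obtain cf Cf where f_bd: "cf > 0" "Cf > 0"
    "\<And>y. \<bar>y\<bar> \<le> Y \<Longrightarrow> cf * \<bar>y\<bar> powr \<alpha> \<le> \<bar>f y\<bar>" "\<And>y. \<bar>y\<bar> \<le> Y \<Longrightarrow> \<bar>f y\<bar> \<le> Cf * \<bar>y\<bar> powr \<alpha>"
    using f_power unfolding power_like_def by meson
  obtain ch Ch where h_bd: "ch > 0" "Ch > 0"
    "\<And>y. \<bar>y\<bar> \<le> Z \<Longrightarrow> ch * \<bar>y\<bar> powr a2 \<le> \<bar>h y\<bar>" "\<And>y. \<bar>y\<bar> \<le> Z \<Longrightarrow> \<bar>h y\<bar> \<le> Ch * \<bar>y\<bar> powr a2"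
    using h_power unfolding power_like_def a2_def by meson
  obtain D1 where D1: "D1 > 0" "\<And>x i. (x i)\<^sup>2 \<le> D1 * dform w p x" using coordinate_le_dform by blast
  obtain D2 where D2: "D2 > 0" "\<And>x. dform w p x \<le> D2 * (\<Sum>i\<in>UNIV. (lap w p x i)\<^sup>2)"
    using dform_le_lap by blast
  define n where "n = real CARD('n)"
  have n: "n > 0" by (simp add: n_def)
  \<comment> \<open>Chosen so that a component with \<open>\<bar>y j\<bar> \<le> Y\<close> and
    potential at least x/(4n) satisfies \<open>\<theta> * L \<le> \<bar>y j\<bar>\<close>, where
    \<open>L\<close> is the scale of \<open>y\<close> at level x.\<close>
  define \<theta> where "\<theta> = (1 / (4 * n * Cf)) powr (1 / (1 + \<alpha>))"
  have th: "\<theta> > 0" using n f_bd by (simp add: \<theta>_def)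
  \<comment> \<open>The force term contributed by such a component, in units of x; it is halved
    because the denominator \<open>1 + (d j / S)\<^sup>2\<close> may reach 2.\<close>
  define c0 where "c0 = arctan \<theta> * cf * \<theta> powr \<alpha> / 2"
  have c0: "c0 > 0" using th f_bd by (simp add: c0_def zero_less_arctan_iff)
  \<comment> \<open>If every \<open>lap w p d i\<close> is at most \<delta> sqrt x in absolute
    value, then \<open>dform w p d\<close> is at most x/(2 + D1). The 2 caps the kinetic energy at
    x/4, and D1 ensures \<open>(d j)\<^sup>2 \<le> x\<close>.\<close>
  define \<delta> where "\<delta> = 1 / sqrt (D2 * n * (2 + D1))"
  have d: "\<delta> > 0" using D1 D2 n by (simp add: \<delta>_def)
  have d2: "\<delta>\<^sup>2 = 1 / (D2 * n * (2 + D1))" using D1 D2 n by (simp add: \<delta>_def power_divide)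
  \<comment> \<open>The constant is split over the n components, so the cross terms use up only half
    of the gain c0 x.\<close>
  obtain K where K: "K > 0" "\<And>u. u \<ge> 0 \<Longrightarrow> 2 * u + 2 * Ch * u powr a2 \<le> K * u powr (1 + a2) + c0 / (2 * n)"
    using lower_powers_absorbed[of 2 "2 * Ch" "c0 / (2 * n)" a2] h_bd c0 n a2 by auto
  \<comment> \<open>The damping is spent twice: the part with \<open>K\<close> pays for the cross
    terms, and the other part alone yields c0 x as soon as some \<open>lap w p d j\<close> exceeds
    \<delta> sqrt x in absolute value.\<close>
  define \<mu> where "\<mu> = (K + c0 / \<delta> powr (1 + a2)) / ch"
  have mu: "\<mu> > 0" using K c0 d h_bd by (simp add: \<mu>_def add_pos_pos)
  have "(\<Sum>i\<in>UNIV. lap w p d i / (1 + (y i / x powr (1 / (1 + \<alpha>)))\<^sup>2) * (sqrt x * arctan (d i / sqrt x))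
        - x powr (1 / (1 + \<alpha>)) * arctan (y i / x powr (1 / (1 + \<alpha>)))
          * ((f (y i) + h (lap w p d i)) / (1 + (d i / sqrt x)\<^sup>2)))
      - \<mu> * x powr \<omega> * (\<Sum>i\<in>UNIV. lap w p d i * h (lap w p d i)) \<le> - (c0 / 2) * x"
    if x: "x > 0" and Z: "\<And>i. \<bar>lap w p d i\<bar> \<le> Z"
      and energy: "x / 2 \<le> dform w p d / 2 + (\<Sum>i | \<bar>y i\<bar> \<le> Y. \<Phi> (y i))" for x y d
  proof -
    define z where "z i = lap w p d i" for i
    define S where "S = sqrt x"
    define L where "L = x powr (1 / (1 + \<alpha>))"
    define u where "u i = \<bar>z i\<bar> / S" for i
    define G where "G i = L * arctan (y i / L) * (f (y i) / (1 + (d i / S)\<^sup>2))" for i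
    have S: "S > 0" "S * S = x" using x by (auto simp: S_def)
    have L: "L > 0" using x by (simp add: L_def)
    have Sp: "S powr r = x powr (r / 2)" for r
      using x by (simp add: S_def powr_half_sqrt[symmetric] powr_powr)
    have a2_eq: "a2 = 2 - 2 * (1 / (1 + \<alpha>))" using alpha by (simp add: a2_def field_simps)
    \<comment> \<open>Here and in the next product the value of \<open>a2\<close> enters: both scale
      exactly like x, so the cross terms and the damping become x times functions of the scaled
      speeds \<open>u i\<close>.\<close>
    have LS: "L * S powr a2 = x"
    proof -
      have "1 / (1 + \<alpha>) + a2 / 2 = 1" using a2_eq by argo
      thus ?thesis using x unfolding L_def Sp by (simp add: powr_add[symmetric])
    qed
    have WS: "x powr \<omega> * S powr (1 + a2) = x"
    proof -
      have "0 < 2 + (\<alpha> * 4 + \<alpha> * (\<alpha> * 2))" using alpha by (intro add_pos_pos mult_pos_pos) auto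
      hence "\<omega> = 1 / (1 + \<alpha>) - 1 / 2" using alpha by (simp add: field_simps)
      hence "\<omega> + (1 + a2) / 2 = 1" using a2_eq by argo
      thus ?thesis using x unfolding Sp by (simp add: powr_add[symmetric])
    qed
    have LL: "L * L powr \<alpha> = x"
    proof -
      have "1 / (1 + \<alpha>) + 1 / (1 + \<alpha>) * \<alpha> = 1" using alpha by (simp add: field_simps)
      thus ?thesis using x unfolding L_def powr_powr by (simp add: powr_add[symmetric])
    qed
    have zu: "\<bar>z i\<bar> = S * u i" for i using S by (simp add: u_def)
    have u0: "u i \<ge> 0" for i using S by (simp add: u_def)
    \<comment> \<open>The denominator is at least 1 and the arctangent is bounded, so this cross
      term needs no bound on \<open>y i\<close> or \<open>d i\<close>.\<close>
    have t1: "z i / (1 + (y i / L)\<^sup>2) * (S * arctan (d i / S)) \<le> x * (2 * u i)" for i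
    proof -
      have "\<bar>z i / (1 + (y i / L)\<^sup>2)\<bar> \<le> \<bar>z i\<bar>"
        by (simp add: abs_divide divide_le_eq mult_le_cancel_left1 add_pos_nonneg)
      moreover have "\<bar>S * arctan (d i / S)\<bar> \<le> S * 2"
        using S arctan_abs_le_2[of "d i / S"] by (simp add: abs_mult)
      ultimately have "\<bar>z i / (1 + (y i / L)\<^sup>2) * (S * arctan (d i / S))\<bar> \<le> \<bar>z i\<bar> * (S * 2)"
        unfolding abs_mult[of "z i / _"] by (intro mult_mono) auto
      also have "\<dots> = x * (2 * u i)" unfolding zu S(2)[symmetric] by simp
      finally show ?thesis by linarith
    qed
    have t2: "- (L * arctan (y i / L) * (h (z i) / (1 + (d i / S)\<^sup>2))) \<le> x * (2 * Ch * u i powr a2)" for i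
    proof -
      have "\<bar>h (z i) / (1 + (d i / S)\<^sup>2)\<bar> \<le> \<bar>h (z i)\<bar>"
        by (simp add: abs_divide divide_le_eq mult_le_cancel_left1 add_pos_nonneg)
      also have "\<dots> \<le> Ch * \<bar>z i\<bar> powr a2" using h_bd(4) Z by (simp add: z_def)
      finally have "\<bar>h (z i) / (1 + (d i / S)\<^sup>2)\<bar> \<le> Ch * \<bar>z i\<bar> powr a2" .
      moreover have "\<bar>L * arctan (y i / L)\<bar> \<le> L * 2"
        using L arctan_abs_le_2[of "y i / L"] by (simp add: abs_mult)
      ultimately have "\<bar>L * arctan (y i / L) * (h (z i) / (1 + (d i / S)\<^sup>2))\<bar> \<le> L * 2 * (Ch * \<bar>z i\<bar> powr a2)"
        unfolding abs_mult[of "L * arctan _"] using L by (intro mult_mono) auto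
      also have "\<dots> = (L * S powr a2) * (2 * Ch * u i powr a2)"
        unfolding zu using S u0[of i] by (simp add: powr_mult)
      finally show ?thesis unfolding LS by linarith
    qed
    have t3: "x powr \<omega> * (z i * h (z i)) \<ge> ch * x * u i powr (1 + a2)" for i
    proof -
      have "z i * h (z i) = \<bar>z i\<bar> * \<bar>h (z i)\<bar>" using h_nonneg[of "z i"] by (metis abs_mult abs_of_nonneg)
      moreover have "\<bar>z i\<bar> * \<bar>h (z i)\<bar> \<ge> \<bar>z i\<bar> * (ch * \<bar>z i\<bar> powr a2)"
        using h_bd(3) Z by (intro mult_left_mono) (auto simp: z_def)
      moreover have "\<bar>z i\<bar> * (ch * \<bar>z i\<bar> powr a2) = ch * \<bar>z i\<bar> powr (1 + a2)"
        by (cases "z i = 0") (auto simp: powr_add)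
      ultimately have "ch * \<bar>z i\<bar> powr (1 + a2) \<le> z i * h (z i)" by simp
      hence "x powr \<omega> * (ch * \<bar>z i\<bar> powr (1 + a2)) \<le> x powr \<omega> * (z i * h (z i))"
        by (intro mult_left_mono) auto
      moreover have "x powr \<omega> * (ch * \<bar>z i\<bar> powr (1 + a2)) = ch * (x powr \<omega> * S powr (1 + a2)) * u i powr (1 + a2)"
        unfolding zu using S u0[of i] by (simp add: powr_mult)
      ultimately show ?thesis unfolding WS by linarith
    qed
    \<comment> \<open>For components beyond \<open>Y\<close> this sign is the only information used;
      their force has no uniform positive lower bound.\<close>
    have G0: "G i \<ge> 0" for i
    proof -
      have "arctan (y i / L) * f (y i) \<ge> 0"
        using f_nonneg[of "y i"] L by (auto simp: zero_le_mult_iff divide_le_0_iff)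
      hence "L * (arctan (y i / L) * f (y i)) \<ge> 0" by (rule mult_nonneg_nonneg[OF less_imp_le[OF L]])
      hence "L * (arctan (y i / L) * f (y i)) / (1 + (d i / S)\<^sup>2) \<ge> 0" by (rule divide_nonneg_nonneg) simp
      thus ?thesis by (simp add: G_def mult_ac)
    qed
    \<comment> \<open>A dichotomy. If some scaled speed exceeds \<delta>, the damping suffices.
      Otherwise the kinetic energy is at most x/4, so one component within \<open>Y\<close> carries
      potential at least x/(4n), and its force term suffices.\<close>
    have low: "(\<Sum>i\<in>UNIV. G i) + c0 / \<delta> powr (1 + a2) * x * (\<Sum>i\<in>UNIV. u i powr (1 + a2)) \<ge> c0 * x"
    proof (cases "\<exists>j. u j > \<delta>")
      case True
      then obtain j where j: "u j > \<delta>" by blast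
      have "\<delta> powr (1 + a2) \<le> u j powr (1 + a2)" using j d a2 by (intro powr_mono2) auto
      also have "\<dots> \<le> (\<Sum>i\<in>UNIV. u i powr (1 + a2))" by (intro member_le_sum) auto
      finally have "c0 / \<delta> powr (1 + a2) * x * (\<delta> powr (1 + a2)) \<le> c0 / \<delta> powr (1 + a2) * x * (\<Sum>i\<in>UNIV. u i powr (1 + a2))"
        using c0 x by (intro mult_left_mono) auto
      moreover have "c0 / \<delta> powr (1 + a2) * x * (\<delta> powr (1 + a2)) = c0 * x" using d by simp
      moreover have "(\<Sum>i\<in>UNIV. G i) \<ge> 0" using G0 by (intro sum_nonneg) auto
      ultimately show ?thesis by linarith
    next
      case False
      hence ud: "u i \<le> \<delta>" for i by (meson not_le)
      have "(z i)\<^sup>2 \<le> x * \<delta>\<^sup>2" for i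
      proof -
        have "(z i)\<^sup>2 = x * (u i)\<^sup>2" using zu[of i] S(2) by (metis power2_abs power2_eq_square power_mult_distrib)
        thus ?thesis using ud[of i] u0[of i] x by (simp add: power_mono)
      qed
      hence "(\<Sum>i\<in>UNIV. (z i)\<^sup>2) \<le> (\<Sum>i\<in>(UNIV::'n set). x * \<delta>\<^sup>2)" by (intro sum_mono) auto
      hence "(\<Sum>i\<in>UNIV. (z i)\<^sup>2) \<le> n * (x * \<delta>\<^sup>2)" by (simp add: n_def)
      hence "dform w p d \<le> D2 * (n * (x * \<delta>\<^sup>2))"
        using D2(2)[of d] D2(1) unfolding z_def by (meson mult_left_mono less_imp_le order_trans)
      also have "\<dots> = x / (2 + D1)" unfolding d2 using D2 n by simp
      finally have df: "dform w p d \<le> x / (2 + D1)" .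
      have "x / (2 + D1) \<le> x / 2" using x D1 by (intro divide_left_mono) auto
      with df have "dform w p d \<le> x / 2" by (rule order_trans)
      hence "dform w p d / 2 \<le> x / 4" by simp
      hence "x / 4 \<le> (\<Sum>i | \<bar>y i\<bar> \<le> Y. \<Phi> (y i))" using energy by simp
      moreover have "(\<Sum>i | \<bar>y i\<bar> \<le> Y. \<Phi> (y i)) < x / 4" if small: "\<And>i. \<bar>y i\<bar> \<le> Y \<Longrightarrow> \<Phi> (y i) < x / (4 * n)"
      proof -
        have "(\<Sum>i | \<bar>y i\<bar> \<le> Y. \<Phi> (y i)) \<le> (\<Sum>i\<in>UNIV. if \<bar>y i\<bar> \<le> Y then \<Phi> (y i) else 0)"
          by (simp add: sum.If_cases)
        also have "\<dots> < (\<Sum>i\<in>(UNIV :: 'n set). x / (4 * n))"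
          using small x n by (intro sum_strict_mono) auto
        finally show ?thesis using n by (simp add: n_def)
      qed
      ultimately obtain j where j: "\<bar>y j\<bar> \<le> Y" "\<Phi> (y j) \<ge> x / (4 * n)" by (meson not_le)
      have "x / (4 * n) \<le> Cf * \<bar>y j\<bar> powr (1 + \<alpha>)"
        using potential_le_power[OF f_bd(4) j(1) f_bd(2)] j(2) by simp
      hence "1 / (4 * n * Cf) * x \<le> \<bar>y j\<bar> powr (1 + \<alpha>)" using f_bd n by (simp add: field_simps)
      hence "(1 / (4 * n * Cf) * x) powr (1 / (1 + \<alpha>)) \<le> (\<bar>y j\<bar> powr (1 + \<alpha>)) powr (1 / (1 + \<alpha>))"
        using alpha x n f_bd by (intro powr_mono2) auto
      hence yj: "\<theta> * L \<le> \<bar>y j\<bar>"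
        using alpha x n f_bd unfolding \<theta>_def L_def by (simp add: powr_powr powr_mult[symmetric])
      have "(d j)\<^sup>2 \<le> x"
      proof -
        have "(d j)\<^sup>2 \<le> D1 * (x / (2 + D1))" using D1(2)[of d j] df D1(1) by (meson mult_left_mono less_imp_le order_trans)
        also have "\<dots> \<le> x" using D1(1) x by (simp add: field_simps)
        finally show ?thesis .
      qed
      hence dj: "(d j / S)\<^sup>2 \<le> 1" using S x by (simp add: power_divide power2_eq_square[of S])
      have "arctan (y j / L) * f (y j) = arctan (\<bar>y j\<bar> / L) * \<bar>f (y j)\<bar>"
      proof (cases "y j = 0")
        case False
        hence "y j > 0 \<and> f (y j) > 0 \<or> y j < 0 \<and> f (y j) < 0"
          using f_pos[of "y j"] by (simp add: zero_less_mult_iff)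
        thus ?thesis by (auto simp: arctan_minus)
      qed simp
      also have "\<dots> \<ge> arctan \<theta> * (cf * (\<theta> * L) powr \<alpha>)"
      proof (rule mult_mono)
        show "arctan \<theta> \<le> arctan (\<bar>y j\<bar> / L)" using yj L by (simp add: arctan_le_iff pos_le_divide_eq)
        have "cf * (\<theta> * L) powr \<alpha> \<le> cf * \<bar>y j\<bar> powr \<alpha>"
          using yj th L alpha f_bd by (intro mult_left_mono powr_mono2) auto
        thus "cf * (\<theta> * L) powr \<alpha> \<le> \<bar>f (y j)\<bar>" using f_bd(3)[OF j(1)] by simp
      qed (use L f_bd in auto)
      finally have "L * (arctan (y j / L) * f (y j)) \<ge> L * (arctan \<theta> * (cf * (\<theta> * L) powr \<alpha>))"
        using L by (intro mult_left_mono) auto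
      also have "L * (arctan \<theta> * (cf * (\<theta> * L) powr \<alpha>)) = 2 * c0 * (L * L powr \<alpha>)"
        using th L by (simp add: c0_def powr_mult)
      finally have A: "2 * c0 * x \<le> L * (arctan (y j / L) * f (y j))" unfolding LL .
      have "c0 * x * (1 + (d j / S)\<^sup>2) \<le> c0 * x * 2" using dj c0 x by (intro mult_left_mono) auto
      hence "c0 * x * (1 + (d j / S)\<^sup>2) \<le> L * (arctan (y j / L) * f (y j))" using A by simp
      hence "c0 * x \<le> G j"
        by (simp add: G_def pos_le_divide_eq add_pos_nonneg mult_ac)
      also have "\<dots> \<le> (\<Sum>i\<in>UNIV. G i)" using G0 by (intro member_le_sum) auto
      finally show ?thesis using c0 d x by (smt (verit) divide_nonneg_nonneg mult_nonneg_nonneg powr_ge_zero sum_nonneg)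
    qed
    have "(\<Sum>i\<in>UNIV. z i / (1 + (y i / L)\<^sup>2) * (S * arctan (d i / S))
        - L * arctan (y i / L) * ((f (y i) + h (z i)) / (1 + (d i / S)\<^sup>2)))
        \<le> (\<Sum>i\<in>UNIV. x * (K * u i powr (1 + a2)) + x * c0 / (2 * n) - G i)"
    proof (rule sum_mono)
      fix i
      have "z i / (1 + (y i / L)\<^sup>2) * (S * arctan (d i / S))
        - L * arctan (y i / L) * ((f (y i) + h (z i)) / (1 + (d i / S)\<^sup>2))
        = z i / (1 + (y i / L)\<^sup>2) * (S * arctan (d i / S))
          - (L * arctan (y i / L) * (h (z i) / (1 + (d i / S)\<^sup>2))) - G i"
        by (simp add: G_def add_divide_distrib distrib_left)
      also have "\<dots> \<le> x * (2 * u i + 2 * Ch * u i powr a2) - G i"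
        using t1[of i] t2[of i] by (simp add: distrib_left)
      also have "\<dots> \<le> x * (K * u i powr (1 + a2) + c0 / (2 * n)) - G i"
        using K(2)[OF u0[of i]] x by (simp add: mult_left_mono)
      finally show "z i / (1 + (y i / L)\<^sup>2) * (S * arctan (d i / S))
        - L * arctan (y i / L) * ((f (y i) + h (z i)) / (1 + (d i / S)\<^sup>2))
        \<le> x * (K * u i powr (1 + a2)) + x * c0 / (2 * n) - G i" by (simp add: distrib_left)
    qed
    also have "\<dots> = x * K * (\<Sum>i\<in>UNIV. u i powr (1 + a2)) + x * c0 / 2 - (\<Sum>i\<in>UNIV. G i)"
      using n by (simp add: sum.distrib sum_subtractf sum_distrib_left n_def mult_ac)
    finally have s1: "(\<Sum>i\<in>UNIV. z i / (1 + (y i / L)\<^sup>2) * (S * arctan (d i / S))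
        - L * arctan (y i / L) * ((f (y i) + h (z i)) / (1 + (d i / S)\<^sup>2)))
        \<le> x * K * (\<Sum>i\<in>UNIV. u i powr (1 + a2)) + x * c0 / 2 - (\<Sum>i\<in>UNIV. G i)" .
    have "(\<Sum>i\<in>UNIV. ch * x * u i powr (1 + a2)) \<le> (\<Sum>i\<in>UNIV. x powr \<omega> * (z i * h (z i)))"
      by (rule sum_mono[OF t3])
    hence "\<mu> * (ch * x * (\<Sum>i\<in>UNIV. u i powr (1 + a2))) \<le> \<mu> * (x powr \<omega> * (\<Sum>i\<in>UNIV. z i * h (z i)))"
      unfolding sum_distrib_left[symmetric] using mu by (intro mult_left_mono) auto
    moreover have "\<mu> * (ch * x * (\<Sum>i\<in>UNIV. u i powr (1 + a2)))
       = x * K * (\<Sum>i\<in>UNIV. u i powr (1 + a2)) + c0 / \<delta> powr (1 + a2) * x * (\<Sum>i\<in>UNIV. u i powr (1 + a2))"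
      using h_bd(1) by (simp add: \<mu>_def field_simps)
    ultimately have s2: "x * K * (\<Sum>i\<in>UNIV. u i powr (1 + a2)) + c0 / \<delta> powr (1 + a2) * x * (\<Sum>i\<in>UNIV. u i powr (1 + a2))
       \<le> \<mu> * x powr \<omega> * (\<Sum>i\<in>UNIV. z i * h (z i))" by (simp add: mult.assoc)
    show ?thesis using s1 s2 low unfolding z_def S_def L_def by argo
  qed
  thus ?thesis using mu c0 by (intro exI[of _ \<mu>] conjI exI[of _ "c0 / 2"]) auto
qed

section \<open>The energy along trajectories\<close>

definition energy :: "('n \<Rightarrow> real) \<Rightarrow> ('n \<Rightarrow> real) \<Rightarrow> real" where
  "energy e d = (\<Sum>i\<in>UNIV. \<Phi> (lap w p e i)) + dform w p d / 2"

text \<open>Right derivatives on the half-open interval, with continuity up to its right end, fit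
  one dwell interval: at the right end the equation of the next formation already applies. The input
  \<open>b\<close> is the estimation error, which is 0 once the estimator has settled.\<close>

definition trajectory ::
    "('n \<Rightarrow> real \<Rightarrow> real) \<Rightarrow> real \<Rightarrow> real \<Rightarrow> ('n \<Rightarrow> real \<Rightarrow> real) \<Rightarrow> ('n \<Rightarrow> real \<Rightarrow> real) \<Rightarrow> bool" where
  "trajectory b s u e d \<longleftrightarrow> (\<forall>i. continuous_on {s..u} (e i) \<and> continuous_on {s..u} (d i)
     \<and> (\<forall>t. s \<le> t \<and> t < u \<longrightarrow> (e i has_real_derivative d i t) (at t within {t..})
         \<and> (d i has_real_derivative b i t - f (lap w p (\<lambda>j. e j t) i) - h (lap w p (\<lambda>j. d j t) i))
             (at t within {t..})))"

lemma trajectory_subinterval: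
  "trajectory b s u e d \<Longrightarrow> s \<le> s' \<Longrightarrow> u' \<le> u \<Longrightarrow> trajectory b s' u' e d"
  unfolding trajectory_def
  using continuous_on_subset[of "{s..u}" _ "{s'..u'}"] by fastforce

lemma continuous_on_energy:
  assumes "trajectory b s u e d"
  shows "continuous_on {s..u} (\<lambda>t. energy (\<lambda>j. e j t) (\<lambda>j. d j t))"
proof -
  have c: "continuous_on {s..u} (e i)" "continuous_on {s..u} (d i)" for i
    using assms unfolding trajectory_def by auto
  have P: "continuous_on UNIV \<Phi>" using potential by (meson DERIV_continuous_on)
  show ?thesis unfolding energy_def dform_def
    by (intro continuous_intros continuous_on_compose2[OF P] continuous_on_lap c) auto
qed

text \<open>The kinetic part is weighted by the grounded Laplacian, whose self-adjointness makes the
  power of the restoring force cancel the derivative of the potential. What is left is input power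
  minus dissipation.\<close>

lemma energy_derivative:
  assumes traj: "trajectory b s u e d" and t: "s \<le> t" "t < u"
  shows "((\<lambda>t. energy (\<lambda>j. e j t) (\<lambda>j. d j t)) has_real_derivative
     (\<Sum>i\<in>UNIV. lap w p (\<lambda>j. d j t) i * b i t)
      - (\<Sum>i\<in>UNIV. lap w p (\<lambda>j. d j t) i * h (lap w p (\<lambda>j. d j t) i))) (at t within {t..})"
proof -
  define y where "y i = lap w p (\<lambda>j. e j t) i" for i
  define z where "z i = lap w p (\<lambda>j. d j t) i" for i
  define d' where "d' i = b i t - f (y i) - h (z i)" for i
  have de: "(e i has_real_derivative d i t) (at t within {t..})"
    and dd: "(d i has_real_derivative d' i) (at t within {t..})" for i
    using traj t unfolding trajectory_def d'_def y_def z_def by auto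
  have dy: "((\<lambda>t. lap w p (\<lambda>j. e j t) i) has_real_derivative z i) (at t within {t..})" for i
    unfolding z_def by (rule has_derivative_lap[OF de])
  have dz: "((\<lambda>t. lap w p (\<lambda>j. d j t) i) has_real_derivative lap w p d' i) (at t within {t..})" for i
    by (rule has_derivative_lap[OF dd])
  have "((\<lambda>t. energy (\<lambda>j. e j t) (\<lambda>j. d j t)) has_real_derivative
     (\<Sum>i\<in>UNIV. f (y i) * z i) + (\<Sum>i\<in>UNIV. d' i * z i + lap w p d' i * d i t) / 2) (at t within {t..})"
    unfolding energy_def dform_def
  proof (intro DERIV_add DERIV_sum DERIV_cdivide)
    show "((\<lambda>t. \<Phi> (lap w p (\<lambda>j. e j t) i)) has_real_derivative f (y i) * z i) (at t within {t..})" for i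
      unfolding y_def by (rule DERIV_chain2[OF potential dy])
    show "((\<lambda>t. d i t * lap w p (\<lambda>j. d j t) i) has_real_derivative d' i * z i + lap w p d' i * d i t)
       (at t within {t..})" for i
      unfolding z_def by (rule DERIV_mult[OF dd dz])
  qed
  moreover have "(\<Sum>i\<in>UNIV. f (y i) * z i) + (\<Sum>i\<in>UNIV. d' i * z i + lap w p d' i * d i t) / 2
      = (\<Sum>i\<in>UNIV. z i * b i t) - (\<Sum>i\<in>UNIV. z i * h (z i))"
  proof -
    have "(\<Sum>i\<in>UNIV. lap w p d' i * d i t) = (\<Sum>i\<in>UNIV. d' i * z i)"
      using lap_self_adjoint[of d' "\<lambda>j. d j t"] by (simp add: z_def mult.commute)
    hence "(\<Sum>i\<in>UNIV. d' i * z i + lap w p d' i * d i t) / 2 = (\<Sum>i\<in>UNIV. d' i * z i)"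
      by (simp add: sum.distrib)
    moreover have "(\<Sum>i\<in>UNIV. f (y i) * z i) + (\<Sum>i\<in>UNIV. d' i * z i)
        = (\<Sum>i\<in>UNIV. z i * b i t) - (\<Sum>i\<in>UNIV. z i * h (z i))"
      unfolding d'_def by (simp add: sum.distrib[symmetric] sum_subtractf[symmetric] algebra_simps)
    ultimately show ?thesis by simp
  qed
  ultimately show ?thesis by (simp add: z_def)
qed

lemma energy_antimono:
  assumes "trajectory (\<lambda>_ _. 0) s u e d" "s \<le> t" "t \<le> t'" "t' \<le> u"
  shows "energy (\<lambda>j. e j t') (\<lambda>j. d j t') \<le> energy (\<lambda>j. e j t) (\<lambda>j. d j t)"
proof -
  have tr: "trajectory (\<lambda>_ _. 0) t t' e d" using assms by (intro trajectory_subinterval[OF assms(1)])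
  show ?thesis
    using right_derivative_upper_bound[OF assms(3) continuous_on_energy[OF tr] energy_derivative[OF tr], of 0]
    by (simp add: sum_nonneg h_nonneg)
qed

lemma energy_nonneg: "energy e d \<ge> 0"
  unfolding energy_def by (intro add_nonneg_nonneg sum_nonneg potential_nonneg divide_nonneg_nonneg dform_nonneg) auto

text \<open>The kinetic part is positive definite and the potential is nonnegative, so the energy
  controls speeds. It gives no such control of positions, since \<Phi> may be bounded.\<close>

lemma speed_le_energy:
  "\<exists>C>0. \<forall>e d i. \<bar>d i\<bar> \<le> C * sqrt (energy e d) \<and> \<bar>lap w p d i\<bar> \<le> C * sqrt (energy e d)"
proof -
  obtain D where D: "D > 0" "\<And>x i. (x i)\<^sup>2 \<le> D * dform w p x" using coordinate_le_dform by blast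
  obtain A where A: "A > 0" "\<And>x B i. (\<And>j. \<bar>x j\<bar> \<le> B) \<Longrightarrow> \<bar>lap w p x i\<bar> \<le> A * B"
    using lap_abs_bound[of w p] by blast
  define C where "C = sqrt (2 * D) * (1 + A)"
  have C: "C > 0" using D A by (simp add: C_def)
  have "\<bar>d i\<bar> \<le> C * sqrt (energy e d) \<and> \<bar>lap w p d i\<bar> \<le> C * sqrt (energy e d)" for e d i
  proof -
    have d: "\<bar>d j\<bar> \<le> sqrt (2 * D) * sqrt (energy e d)" for j
    proof -
      have "dform w p d \<le> 2 * energy e d"
        unfolding energy_def by (simp add: sum_nonneg potential_nonneg)
      hence "D * dform w p d \<le> D * (2 * energy e d)" using D(1) by (intro mult_left_mono) auto
      hence "(d j)\<^sup>2 \<le> 2 * D * energy e d" using D(2)[of d j] by simp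
      hence "sqrt ((d j)\<^sup>2) \<le> sqrt (2 * D * energy e d)" by (rule real_sqrt_le_mono)
      thus ?thesis by (simp add: real_sqrt_mult)
    qed
    have s: "sqrt (2 * D) * sqrt (energy e d) \<ge> 0" using D energy_nonneg[of e d] by simp
    have "\<bar>lap w p d i\<bar> \<le> A * (sqrt (2 * D) * sqrt (energy e d))" using A(2) d by blast
    moreover have "C * sqrt (energy e d) = sqrt (2 * D) * sqrt (energy e d) + A * (sqrt (2 * D) * sqrt (energy e d))"
      by (simp add: C_def algebra_simps)
    moreover have "A * (sqrt (2 * D) * sqrt (energy e d)) \<ge> 0" using s A by simp
    ultimately show ?thesis using d[of i] s by linarith
  qed
  thus ?thesis using C by blast
qed

section \<open>Decay of the excess energy in uniform time\<close>

lemma lap_displacement: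
  assumes traj: "trajectory b s u e d" and "s \<le> t" "t \<le> u"
    and Z: "\<And>t'. s \<le> t' \<Longrightarrow> t' < t \<Longrightarrow> \<bar>lap w p (\<lambda>j. d j t') i\<bar> \<le> Z"
  shows "\<bar>lap w p (\<lambda>j. e j t) i\<bar> \<le> \<bar>lap w p (\<lambda>j. e j s) i\<bar> + Z * (t - s)"
proof (rule right_derivative_displacement[OF assms(2)])
  show "continuous_on {s..t} (\<lambda>t. lap w p (\<lambda>j. e j t) i)"
    using trajectory_subinterval[OF traj order_refl assms(3)] unfolding trajectory_def
    by (intro continuous_on_lap) auto
  show "((\<lambda>t. lap w p (\<lambda>j. e j t) i) has_real_derivative lap w p (\<lambda>j. d j t') i) (at t' within {t'..})"
    if "s \<le> t'" "t' < t" for t'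
    using traj that assms(3) unfolding trajectory_def by (intro has_derivative_lap) auto
qed (use Z in auto)

text \<open>\<open>E0\<close> is the energy conceded to components beyond \<open>Y\<close>, so the
  excess over \<open>E0\<close> is at most the energy of the remaining ones. Were the excess to stay
  above x/2, the function \<open>U\<close> would fall at rate at least \<epsilon> x, in total by
  more than its values permit. \<open>C\<close> is fixed before \<open>E0\<close>, which later
  allows \<open>E0\<close> to depend on the elapsed time.\<close>

lemma energy_halving:
  "\<exists>C>0. \<forall>x s u e d E0. x > 0 \<longrightarrow> trajectory (\<lambda>_ _. 0) s u e d \<longrightarrow> u = s + C * x powr \<omega> \<longrightarrow>
     (\<forall>t. s \<le> t \<and> t \<le> u \<longrightarrow> (\<forall>i. \<bar>lap w p (\<lambda>j. d j t) i\<bar> \<le> Z) \<and>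
        energy (\<lambda>j. e j t) (\<lambda>j. d j t) - E0
          \<le> dform w p (\<lambda>j. d j t) / 2 + (\<Sum>i | \<bar>lap w p (\<lambda>j. e j t) i\<bar> \<le> Y. \<Phi> (lap w p (\<lambda>j. e j t) i))) \<longrightarrow>
     energy (\<lambda>j. e j s) (\<lambda>j. d j s) - E0 \<le> x \<longrightarrow>
     energy (\<lambda>j. e j u) (\<lambda>j. d j u) - E0 \<le> x / 2"
proof -
  obtain \<mu> \<epsilon> where mu: "\<mu> > 0" and eps: "\<epsilon> > 0" and diss: "\<And>x y d. x > 0 \<Longrightarrow> (\<And>i. \<bar>lap w p d i\<bar> \<le> Z) \<Longrightarrow>
    x / 2 \<le> dform w p d / 2 + (\<Sum>i | \<bar>y i\<bar> \<le> Y. \<Phi> (y i)) \<Longrightarrow>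
    (\<Sum>i\<in>UNIV. lap w p d i / (1 + (y i / x powr (1 / (1 + \<alpha>)))\<^sup>2) * (sqrt x * arctan (d i / sqrt x))
        - x powr (1 / (1 + \<alpha>)) * arctan (y i / x powr (1 / (1 + \<alpha>)))
          * ((f (y i) + h (lap w p d i)) / (1 + (d i / sqrt x)\<^sup>2)))
      - \<mu> * x powr \<omega> * (\<Sum>i\<in>UNIV. lap w p d i * h (lap w p d i)) \<le> - \<epsilon> * x"
    using virtual_dissipation[of Z Y] by blast
  define n where "n = real CARD('n)"
  \<comment> \<open>Counted in units of L S = x^(1+\<omega>): the arctangent sum has n terms, each
    at most 4 in absolute value at either end, and the energy term of \<open>U\<close> drops by at
    most \<mu>. The remaining 1 makes the contradiction strict.\<close>
  define C where "C = (8 * n + \<mu> + 1) / \<epsilon>"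
  have n: "n > 0" by (simp add: n_def)
  have C: "C > 0" using n mu eps by (simp add: C_def)
  have "energy (\<lambda>j. e j u) (\<lambda>j. d j u) - E0 \<le> x / 2"
    if x: "x > 0" and traj: "trajectory (\<lambda>_ _. 0) s u e d" and u: "u = s + C * x powr \<omega>"
      and Z: "\<And>t i. s \<le> t \<Longrightarrow> t \<le> u \<Longrightarrow> \<bar>lap w p (\<lambda>j. d j t) i\<bar> \<le> Z"
      and E0: "\<And>t. s \<le> t \<Longrightarrow> t \<le> u \<Longrightarrow> energy (\<lambda>j. e j t) (\<lambda>j. d j t) - E0
          \<le> dform w p (\<lambda>j. d j t) / 2 + (\<Sum>i | \<bar>lap w p (\<lambda>j. e j t) i\<bar> \<le> Y. \<Phi> (lap w p (\<lambda>j. e j t) i))"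
      and start: "energy (\<lambda>j. e j s) (\<lambda>j. d j s) - E0 \<le> x" for x s u e d E0
  proof (rule ccontr)
    assume neg: "\<not> ?thesis"
    define E where "E t = energy (\<lambda>j. e j t) (\<lambda>j. d j t)" for t
    define L where "L = x powr (1 / (1 + \<alpha>))"
    define S where "S = sqrt x"
    define y where "y i t = lap w p (\<lambda>j. e j t) i" for i t
    define z where "z i t = lap w p (\<lambda>j. d j t) i" for i t
    define U where "U t = (\<Sum>i\<in>UNIV. L * arctan (y i t / L) * (S * arctan (d i t / S))) + \<mu> * x powr \<omega> * E t" for t
    define D where "D t = (\<Sum>i\<in>UNIV. z i t / (1 + (y i t / L)\<^sup>2) * (S * arctan (d i t / S))
        - L * arctan (y i t / L) * ((f (y i t) + h (z i t)) / (1 + (d i t / S)\<^sup>2)))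
      - \<mu> * x powr \<omega> * (\<Sum>i\<in>UNIV. z i t * h (z i t))" for t
    have L: "L > 0" and S: "S > 0" using x by (auto simp: L_def S_def)
    have su: "s \<le> u" using u C by simp
    have LS: "L * S = x * x powr \<omega>"
    proof -
      have "0 < 2 + (\<alpha> * 4 + \<alpha> * (\<alpha> * 2))" using alpha by (intro add_pos_pos mult_pos_pos) auto
      hence "1 / (1 + \<alpha>) + 1 / 2 = 1 + \<omega>" using alpha by (simp add: field_simps)
      thus ?thesis using x
        by (simp add: L_def S_def powr_half_sqrt[symmetric] powr_add[symmetric] powr_mult_base)
    qed
    have cE: "continuous_on {s..u} E" unfolding E_def by (rule continuous_on_energy[OF traj])
    have ce: "continuous_on {s..u} (e i)" "continuous_on {s..u} (d i)" for i
      using traj unfolding trajectory_def by auto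
    have cU: "continuous_on {s..u} U" unfolding U_def y_def using L S
      by (intro continuous_intros cE continuous_on_lap ce) auto
    have dU: "(U has_real_derivative D t) (at t within {t..})" if t: "s \<le> t" "t < u" for t
    proof -
      have de: "(e i has_real_derivative d i t) (at t within {t..})"
        and dd: "(d i has_real_derivative - f (y i t) - h (z i t)) (at t within {t..})" for i
        using traj t unfolding trajectory_def y_def z_def by (auto)
      have dy: "(y i has_real_derivative z i t) (at t within {t..})" for i
        unfolding z_def y_def by (rule has_derivative_lap[OF de])
      have dE: "(E has_real_derivative - (\<Sum>i\<in>UNIV. z i t * h (z i t))) (at t within {t..})"
        using energy_derivative[OF traj t] unfolding E_def z_def by simp
      have scaled: "((\<lambda>t. r * arctan (g t / r)) has_real_derivative g' / (1 + (g t / r)\<^sup>2)) (at t within {t..})"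
        if "r > 0" "(g has_real_derivative g') (at t within {t..})" for r g' and g :: "real \<Rightarrow> real"
      proof -
        have "((\<lambda>t. g t / r) has_real_derivative g' / r) (at t within {t..})"
          by (rule DERIV_cdivide[OF that(2)])
        from DERIV_cmult[OF DERIV_chain2[OF DERIV_arctan this], of r]
        have "((\<lambda>t. r * arctan (g t / r)) has_real_derivative
            r * (inverse (1 + (g t / r)\<^sup>2) * (g' / r))) (at t within {t..})" .
        moreover have "r * (inverse (1 + (g t / r)\<^sup>2) * (g' / r)) = g' / (1 + (g t / r)\<^sup>2)"
          using that(1) by (simp add: divide_inverse)
        ultimately show ?thesis by simp
      qed
      have "(U has_real_derivative (\<Sum>i\<in>UNIV. z i t / (1 + (y i t / L)\<^sup>2) * (S * arctan (d i t / S))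
          + (- f (y i t) - h (z i t)) / (1 + (d i t / S)\<^sup>2) * (L * arctan (y i t / L)))
          + \<mu> * x powr \<omega> * (- (\<Sum>i\<in>UNIV. z i t * h (z i t)))) (at t within {t..})"
        unfolding U_def
        by (intro DERIV_add DERIV_sum DERIV_mult DERIV_cmult scaled L S dy dd dE)
      moreover have "z i t / (1 + (y i t / L)\<^sup>2) * (S * arctan (d i t / S))
          + (- f (y i t) - h (z i t)) / (1 + (d i t / S)\<^sup>2) * (L * arctan (y i t / L))
        = z i t / (1 + (y i t / L)\<^sup>2) * (S * arctan (d i t / S))
        - L * arctan (y i t / L) * ((f (y i t) + h (z i t)) / (1 + (d i t / S)\<^sup>2))" for i
      proof -
        have "(- f (y i t) - h (z i t)) / (1 + (d i t / S)\<^sup>2) = - ((f (y i t) + h (z i t)) / (1 + (d i t / S)\<^sup>2))"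
          unfolding minus_divide_left by simp
        thus ?thesis by (simp add: mult_ac)
      qed
      ultimately show ?thesis unfolding D_def by simp
    qed
    have Emono: "E u \<le> E t" if "s \<le> t" "t \<le> u" for t
      unfolding E_def using energy_antimono[OF traj] that by simp
    have Dle: "D t \<le> - \<epsilon> * x" if t: "s \<le> t" "t < u" for t
    proof -
      \<comment> \<open>Since the energy never increases, an excess above x/2 at the end was above
        x/2 on the whole interval.\<close>
      have "x / 2 \<le> E t - E0" using neg Emono[of t] t by (simp add: E_def)
      also have "\<dots> \<le> dform w p (\<lambda>j. d j t) / 2 + (\<Sum>i | \<bar>y i t\<bar> \<le> Y. \<Phi> (y i t))"
        using E0[of t] t by (simp add: E_def y_def)
      finally have "x / 2 \<le> dform w p (\<lambda>j. d j t) / 2 + (\<Sum>i | \<bar>y i t\<bar> \<le> Y. \<Phi> (y i t))" .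
      from diss[OF x _ this] show ?thesis using Z[of t] t unfolding D_def L_def S_def z_def by simp
    qed
    have "U u \<le> U s + (- \<epsilon> * x) * (u - s)" by (rule right_derivative_upper_bound[OF su cU dU Dle])
    also have "(- \<epsilon> * x) * (u - s) = - (\<epsilon> * C) * (L * S)"
      unfolding LS u by simp
    also have "\<epsilon> * C = 8 * n + \<mu> + 1" using eps by (simp add: C_def)
    finally have dec: "U u \<le> U s - (8 * n + \<mu> + 1) * (L * S)" by (simp add: algebra_simps)
    have bnd: "\<bar>\<Sum>i\<in>UNIV. L * arctan (y i t / L) * (S * arctan (d i t / S))\<bar> \<le> n * (4 * (L * S))" for t
    proof -
      have "\<bar>\<Sum>i\<in>UNIV. L * arctan (y i t / L) * (S * arctan (d i t / S))\<bar>
          \<le> (\<Sum>i\<in>UNIV. \<bar>L * arctan (y i t / L) * (S * arctan (d i t / S))\<bar>)" by (rule sum_abs)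
      also have "\<dots> \<le> (\<Sum>i\<in>(UNIV::'n set). 4 * (L * S))"
      proof (rule sum_mono)
        fix i
        have "\<bar>arctan (y i t / L)\<bar> * \<bar>arctan (d i t / S)\<bar> \<le> 2 * 2"
          by (intro mult_mono arctan_abs_le_2) auto
        hence "(L * S) * (\<bar>arctan (y i t / L)\<bar> * \<bar>arctan (d i t / S)\<bar>) \<le> (L * S) * 4"
          using L S by (intro mult_left_mono) auto
        thus "\<bar>L * arctan (y i t / L) * (S * arctan (d i t / S))\<bar> \<le> 4 * (L * S)"
          using L S by (simp add: abs_mult mult_ac)
      qed
      finally show ?thesis by (simp add: n_def)
    qed
    have "E s - E u \<le> x" using start neg x by (simp add: E_def)
    hence "\<mu> * x powr \<omega> * (E s - E u) \<le> \<mu> * x powr \<omega> * x" using mu by (intro mult_left_mono) auto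
    also have "\<dots> = \<mu> * (L * S)" unfolding LS by simp
    finally have "\<mu> * x powr \<omega> * E s - \<mu> * x powr \<omega> * E u \<le> \<mu> * (L * S)" by (simp add: right_diff_distrib)
    hence "U s - U u \<le> 8 * n * (L * S) + \<mu> * (L * S)"
      unfolding U_def using bnd[of s] bnd[of u] by linarith
    moreover have "L * S > 0" using L S by simp
    ultimately show False using dec by (simp add: algebra_simps)
  qed
  thus ?thesis using C by (intro exI[of _ C]) blast
qed

text \<open>Halving x shortens the time C x^\<omega> by the factor (1/2)^\<omega> < 1, so infinitely
  many halvings fit into a finite time, which depends on \<open>x0\<close> but not on
  \<open>E0\<close>.\<close>

lemma energy_reaches_level:
  assumes "x0 > 0"
  shows "\<exists>T\<ge>0. \<forall>s u e d E0. trajectory (\<lambda>_ _. 0) s u e d \<longrightarrow> s + T \<le> u \<longrightarrow>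
     (\<forall>t. s \<le> t \<and> t \<le> u \<longrightarrow> (\<forall>i. \<bar>lap w p (\<lambda>j. d j t) i\<bar> \<le> Z) \<and>
        energy (\<lambda>j. e j t) (\<lambda>j. d j t) - E0
          \<le> dform w p (\<lambda>j. d j t) / 2 + (\<Sum>i | \<bar>lap w p (\<lambda>j. e j t) i\<bar> \<le> Y. \<Phi> (lap w p (\<lambda>j. e j t) i))) \<longrightarrow>
     energy (\<lambda>j. e j s) (\<lambda>j. d j s) - E0 \<le> x0 \<longrightarrow>
     energy (\<lambda>j. e j u) (\<lambda>j. d j u) \<le> E0"
proof -
  let ?good = "\<lambda>Z Y s u e d E0. \<forall>t. s \<le> t \<and> t \<le> u \<longrightarrow> (\<forall>i. \<bar>lap w p (\<lambda>j. d j t) i\<bar> \<le> Z) \<and>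
        energy (\<lambda>j. e j t) (\<lambda>j. d j t) - E0
          \<le> dform w p (\<lambda>j. d j t) / 2 + (\<Sum>i | \<bar>lap w p (\<lambda>j. e j t) i\<bar> \<le> Y. \<Phi> (lap w p (\<lambda>j. e j t) i))"
  obtain C where C: "C > 0" and halving: "\<And>x s u e d E0. x > 0 \<Longrightarrow> trajectory (\<lambda>_ _. 0) s u e d \<Longrightarrow>
     u = s + C * x powr \<omega> \<Longrightarrow> ?good Z Y s u e d E0 \<Longrightarrow>
     energy (\<lambda>j. e j s) (\<lambda>j. d j s) - E0 \<le> x \<Longrightarrow> energy (\<lambda>j. e j u) (\<lambda>j. d j u) - E0 \<le> x / 2"
    using energy_halving[of Z Y] by blast
  define q where "q = (1 / 2 :: real) powr \<omega>"
  have om: "\<omega> > 0" using alpha by simp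
  have q: "0 < q" "q < 1" using powr_less_mono2[OF om, of "1/2" 1] by (simp_all add: q_def)
  define \<tau> where "\<tau> k = (\<Sum>j<k. C * x0 powr \<omega> * q ^ j)" for k
  define T where "T = C * x0 powr \<omega> / (1 - q)"
  have T: "T \<ge> 0" using C q by (simp add: T_def)
  have tau_le: "\<tau> k \<le> T" for k
  proof -
    have "(\<Sum>j<k. q ^ j) \<le> 1 / (1 - q)"
      using q by (subst geometric_sum) (auto simp: field_simps)
    hence "C * x0 powr \<omega> * (\<Sum>j<k. q ^ j) \<le> C * x0 powr \<omega> * (1 / (1 - q))"
      using C by (intro mult_left_mono) auto
    thus ?thesis by (simp add: \<tau>_def T_def sum_distrib_left)
  qed
  have tau0: "\<tau> k \<ge> 0" for k unfolding \<tau>_def using C q by (intro sum_nonneg) auto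
  have scale: "(x0 / 2 ^ k) powr \<omega> = x0 powr \<omega> * q ^ k" for k
  proof (induction k)
    case (Suc k)
    have "(x0 / 2 ^ Suc k) powr \<omega> = (x0 / 2 ^ k * (1 / 2)) powr \<omega>" by (simp add: mult.commute)
    also have "\<dots> = (x0 / 2 ^ k) powr \<omega> * q" unfolding q_def using assms by (intro powr_mult)
    finally show ?case unfolding Suc by simp
  qed simp
  have "energy (\<lambda>j. e j u) (\<lambda>j. d j u) \<le> E0"
    if traj: "trajectory (\<lambda>_ _. 0) s u e d" and u: "s + T \<le> u" and good: "?good Z Y s u e d E0"
      and start: "energy (\<lambda>j. e j s) (\<lambda>j. d j s) - E0 \<le> x0" for s u e d E0
  proof -
    define E where "E t = energy (\<lambda>j. e j t) (\<lambda>j. d j t)" for t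
    have layer: "E (s + \<tau> k) - E0 \<le> x0 / 2 ^ k" for k
    proof (induction k)
      case 0
      thus ?case using start by (simp add: \<tau>_def E_def)
    next
      case (Suc k)
      have eq: "s + \<tau> (Suc k) = (s + \<tau> k) + C * (x0 / 2 ^ k) powr \<omega>"
        unfolding scale by (simp add: \<tau>_def mult.assoc)
      have le: "s + \<tau> (Suc k) \<le> u" using tau_le[of "Suc k"] u by linarith
      have ge: "s \<le> s + \<tau> k" using tau0 by simp
      have "E (s + \<tau> (Suc k)) - E0 \<le> x0 / 2 ^ k / 2"
        unfolding E_def
      proof (rule halving[OF _ trajectory_subinterval[OF traj ge le] eq])
        show "0 < x0 / 2 ^ k" using assms by simp
        show "?good Z Y (s + \<tau> k) (s + \<tau> (Suc k)) e d E0" using good ge le by auto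
        show "energy (\<lambda>j. e j (s + \<tau> k)) (\<lambda>j. d j (s + \<tau> k)) - E0 \<le> x0 / 2 ^ k"
          using Suc unfolding E_def .
      qed
      thus ?case by simp
    qed
    \<comment> \<open>All halving times lie before \<open>u\<close> and the energy never increases,
      so \<open>E u\<close> obeys every one of the bounds and no limit in time has to be
      taken.\<close>
    have "E u - E0 \<le> x0 * (1 / 2) ^ k" for k
    proof -
      have "E u \<le> E (s + \<tau> k)" unfolding E_def
        using energy_antimono[OF traj, of "s + \<tau> k" u] tau0[of k] tau_le[of k] u by simp
      thus ?thesis using layer[of k] by (simp add: power_divide)
    qed
    moreover have "(\<lambda>k. x0 * (1 / 2) ^ k) \<longlonglongrightarrow> x0 * 0"
      by (intro tendsto_intros LIMSEQ_power_zero) simp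
    ultimately have "E u - E0 \<le> x0 * 0" by (intro LIMSEQ_le_const) auto
    thus ?thesis by (simp add: E_def)
  qed
  thus ?thesis using T by (intro exI[of _ T]) blast
qed

section \<open>Eliminating the large components\<close>

lemma energy_stage:
  "\<exists>T\<ge>0. \<exists>K'. \<forall>s u e d. trajectory (\<lambda>_ _. 0) s u e d \<longrightarrow> s + T \<le> u \<longrightarrow>
     energy (\<lambda>j. e j s) (\<lambda>j. d j s) \<le> E1 \<longrightarrow> (\<forall>i. \<bar>lap w p (\<lambda>j. e j s) i\<bar> \<le> K) \<longrightarrow>
     (\<forall>t. s \<le> t \<and> t \<le> u \<longrightarrow> card {i. \<bar>lap w p (\<lambda>j. e j t) i\<bar> > Y} \<le> m) \<longrightarrow>
     energy (\<lambda>j. e j (s + T)) (\<lambda>j. d j (s + T)) \<le> real m * \<Phi> K'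
     \<and> (\<forall>i. \<bar>lap w p (\<lambda>j. e j (s + T)) i\<bar> \<le> K')"
proof -
  obtain C where C: "C > 0" "\<And>e d i. \<bar>lap w p d i\<bar> \<le> C * sqrt (energy e d)"
    using speed_le_energy by blast
  define Z where "Z = C * sqrt \<bar>E1\<bar>"
  have Z0: "Z \<ge> 0" using C by (simp add: Z_def)
  define x0 where "x0 = max E1 1"
  have x0: "x0 > 0" by (simp add: x0_def)
  obtain T where T: "T \<ge> 0" and reach: "\<And>s u e d E0. trajectory (\<lambda>_ _. 0) s u e d \<Longrightarrow> s + T \<le> u \<Longrightarrow>
     (\<forall>t. s \<le> t \<and> t \<le> u \<longrightarrow> (\<forall>i. \<bar>lap w p (\<lambda>j. d j t) i\<bar> \<le> Z) \<and>
        energy (\<lambda>j. e j t) (\<lambda>j. d j t) - E0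
          \<le> dform w p (\<lambda>j. d j t) / 2 + (\<Sum>i | \<bar>lap w p (\<lambda>j. e j t) i\<bar> \<le> Y. \<Phi> (lap w p (\<lambda>j. e j t) i))) \<Longrightarrow>
     energy (\<lambda>j. e j s) (\<lambda>j. d j s) - E0 \<le> x0 \<Longrightarrow> energy (\<lambda>j. e j u) (\<lambda>j. d j u) \<le> E0"
    using energy_reaches_level[OF x0, of Z Y] by blast
  \<comment> \<open>Initial bound plus speed times duration. There is no circularity:
    \<open>Z\<close> comes from \<open>E1\<close>, and \<open>T\<close> from \<open>Z\<close>,
    \<open>Y\<close> and \<open>x0\<close>, all before \<open>K'\<close> and the target level
    \<open>real m * \<Phi> K'\<close>.\<close>
  define K' where "K' = K + Z * T"
  have "energy (\<lambda>j. e j (s + T)) (\<lambda>j. d j (s + T)) \<le> real m * \<Phi> K'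
     \<and> (\<forall>i. \<bar>lap w p (\<lambda>j. e j (s + T)) i\<bar> \<le> K')"
    if traj: "trajectory (\<lambda>_ _. 0) s u e d" and u: "s + T \<le> u"
      and E1: "energy (\<lambda>j. e j s) (\<lambda>j. d j s) \<le> E1" and K: "\<And>i. \<bar>lap w p (\<lambda>j. e j s) i\<bar> \<le> K"
      and card: "\<And>t. s \<le> t \<Longrightarrow> t \<le> u \<Longrightarrow> card {i. \<bar>lap w p (\<lambda>j. e j t) i\<bar> > Y} \<le> m" for s u e d
  proof -
    have z: "\<bar>lap w p (\<lambda>j. d j t) i\<bar> \<le> Z" if t: "s \<le> t" "t \<le> s + T" for t i
    proof -
      have "energy (\<lambda>j. e j t) (\<lambda>j. d j t) \<le> \<bar>E1\<bar>"
        using energy_antimono[OF traj order_refl t(1)] t(2) u E1 by linarith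
      hence "C * sqrt (energy (\<lambda>j. e j t) (\<lambda>j. d j t)) \<le> Z" unfolding Z_def using C(1) by simp
      thus ?thesis using C(2)[of "\<lambda>j. d j t" i "\<lambda>j. e j t"] by linarith
    qed
    have y: "\<bar>lap w p (\<lambda>j. e j t) i\<bar> \<le> K'" if t: "s \<le> t" "t \<le> s + T" for t i
    proof -
      have "\<bar>lap w p (\<lambda>j. e j t) i\<bar> \<le> \<bar>lap w p (\<lambda>j. e j s) i\<bar> + Z * (t - s)"
        using t u z by (intro lap_displacement[OF traj]) auto
      also have "\<dots> \<le> K + Z * T" using K[of i] t Z0 by (intro add_mono mult_left_mono) auto
      finally show ?thesis by (simp add: K'_def)
    qed
    have "energy (\<lambda>j. e j (s + T)) (\<lambda>j. d j (s + T)) \<le> real m * \<Phi> K'"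
    \<comment> \<open>The trajectory is cut at \<open>s + T\<close>, because the bound
      \<open>K'\<close> on the components is established only up to that time.\<close>
    proof (rule reach[OF trajectory_subinterval[OF traj order_refl u]])
      show "energy (\<lambda>j. e j s) (\<lambda>j. d j s) - real m * \<Phi> K' \<le> x0"
      proof -
        have "real m * \<Phi> K' \<ge> 0" using potential_nonneg[of K'] by simp
        moreover have "E1 \<le> x0" by (simp add: x0_def)
        ultimately show ?thesis using E1 by linarith
      qed
      show "\<forall>t. s \<le> t \<and> t \<le> s + T \<longrightarrow> (\<forall>i. \<bar>lap w p (\<lambda>j. d j t) i\<bar> \<le> Z) \<and>
        energy (\<lambda>j. e j t) (\<lambda>j. d j t) - real m * \<Phi> K'
          \<le> dform w p (\<lambda>j. d j t) / 2 + (\<Sum>i | \<bar>lap w p (\<lambda>j. e j t) i\<bar> \<le> Y. \<Phi> (lap w p (\<lambda>j. e j t) i))"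
      proof (intro allI impI conjI)
        fix t i assume t: "s \<le> t \<and> t \<le> s + T"
        show "\<bar>lap w p (\<lambda>j. d j t) i\<bar> \<le> Z" using z t by blast
      next
        fix t assume t: "s \<le> t \<and> t \<le> s + T"
        let ?y = "\<lambda>i. lap w p (\<lambda>j. e j t) i"
        have "(\<Sum>i | \<bar>?y i\<bar> > Y. \<Phi> (?y i)) \<le> real (card {i. \<bar>?y i\<bar> > Y}) * \<Phi> K'"
        proof (rule sum_bounded_above)
          fix i
          have "\<bar>?y i\<bar> \<le> \<bar>K'\<bar>" using y[of t i] t by linarith
          thus "\<Phi> (?y i) \<le> \<Phi> K'" by (rule potential_mono)
        qed
        also have "\<dots> \<le> real m * \<Phi> K'"
          using card[of t] t u by (intro mult_right_mono potential_nonneg) auto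
        finally have A: "(\<Sum>i | \<bar>?y i\<bar> > Y. \<Phi> (?y i)) \<le> real m * \<Phi> K'" .
        have "(\<Sum>i\<in>UNIV. \<Phi> (?y i)) = (\<Sum>i | \<bar>?y i\<bar> \<le> Y. \<Phi> (?y i)) + (\<Sum>i | \<bar>?y i\<bar> > Y. \<Phi> (?y i))"
          by (subst sum.union_disjoint[symmetric]) (auto intro!: sum.cong)
        thus "energy (\<lambda>j. e j t) (\<lambda>j. d j t) - real m * \<Phi> K'
          \<le> dform w p (\<lambda>j. d j t) / 2 + (\<Sum>i | \<bar>?y i\<bar> \<le> Y. \<Phi> (?y i))"
          using A unfolding energy_def by linarith
      qed
    qed simp
    thus ?thesis using y[of "s + T"] T by simp
  qed
  thus ?thesis using T by (intro exI[of _ T] conjI exI[of _ K']) auto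
qed

text \<open>Each stage raises the threshold to \<open>K'\<close> and lowers the number of components
  allowed beyond it by one. Threshold, starting bound and energy bound all change, hence the
  generalisation over \<open>Y\<close>, \<open>K\<close> and \<open>E1\<close>.\<close>

lemma energy_vanishes:
  "\<exists>T\<ge>0. \<forall>s u e d. trajectory (\<lambda>_ _. 0) s u e d \<longrightarrow> s + T \<le> u \<longrightarrow>
     energy (\<lambda>j. e j s) (\<lambda>j. d j s) \<le> E1 \<longrightarrow> (\<forall>i. \<bar>lap w p (\<lambda>j. e j s) i\<bar> \<le> K) \<longrightarrow>
     (\<forall>t. s \<le> t \<and> t \<le> u \<longrightarrow> card {i. \<bar>lap w p (\<lambda>j. e j t) i\<bar> > Y} \<le> m) \<longrightarrow>
     energy (\<lambda>j. e j (s + T)) (\<lambda>j. d j (s + T)) \<le> 0"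
proof (induction m arbitrary: Y K E1)
  case 0
  \<comment> \<open>With no component beyond \<open>Y\<close>, the level
    \<open>real 0 * \<Phi> K'\<close> reached by one stage is already 0.\<close>
  show ?case using energy_stage[of E1 K Y 0] by auto
next
  case (Suc m)
  obtain T K' where T: "T \<ge> 0" and stage: "\<And>s u e d. trajectory (\<lambda>_ _. 0) s u e d \<Longrightarrow> s + T \<le> u \<Longrightarrow>
     energy (\<lambda>j. e j s) (\<lambda>j. d j s) \<le> E1 \<Longrightarrow> (\<forall>i. \<bar>lap w p (\<lambda>j. e j s) i\<bar> \<le> K) \<Longrightarrow>
     (\<forall>t. s \<le> t \<and> t \<le> u \<longrightarrow> card {i. \<bar>lap w p (\<lambda>j. e j t) i\<bar> > Y} \<le> Suc m) \<Longrightarrow>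
     energy (\<lambda>j. e j (s + T)) (\<lambda>j. d j (s + T)) \<le> real (Suc m) * \<Phi> K'
     \<and> (\<forall>i. \<bar>lap w p (\<lambda>j. e j (s + T)) i\<bar> \<le> K')"
    using energy_stage[of E1 K Y "Suc m"] by blast
  obtain T' where T': "T' \<ge> 0" and IH: "\<And>s u e d. trajectory (\<lambda>_ _. 0) s u e d \<Longrightarrow> s + T' \<le> u \<Longrightarrow>
     energy (\<lambda>j. e j s) (\<lambda>j. d j s) \<le> real (Suc m) * \<Phi> K' \<Longrightarrow> (\<forall>i. \<bar>lap w p (\<lambda>j. e j s) i\<bar> \<le> K') \<Longrightarrow>
     (\<forall>t. s \<le> t \<and> t \<le> u \<longrightarrow> card {i. \<bar>lap w p (\<lambda>j. e j t) i\<bar> > K'} \<le> m) \<Longrightarrow>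
     energy (\<lambda>j. e j (s + T')) (\<lambda>j. d j (s + T')) \<le> 0"
    using Suc.IH[of "real (Suc m) * \<Phi> K'" K' K'] by blast
  have "energy (\<lambda>j. e j (s + (T + T'))) (\<lambda>j. d j (s + (T + T'))) \<le> 0"
    if traj: "trajectory (\<lambda>_ _. 0) s u e d" and u: "s + (T + T') \<le> u"
      and E1: "energy (\<lambda>j. e j s) (\<lambda>j. d j s) \<le> E1" and K: "\<forall>i. \<bar>lap w p (\<lambda>j. e j s) i\<bar> \<le> K"
      and card: "\<forall>t. s \<le> t \<and> t \<le> u \<longrightarrow> card {i. \<bar>lap w p (\<lambda>j. e j t) i\<bar> > Y} \<le> Suc m" for s u e d
  proof -
    have sT: "s + T \<le> u" "s \<le> s + T" using u T T' by linarith+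
    note st = stage[OF traj sT(1) E1 K card]
    \<comment> \<open>Strict monotonicity of \<Phi> compares absolute values, so the comparison with
      \<open>\<Phi> K'\<close> needs a nonnegative threshold.\<close>
    have K'0: "K' \<ge> 0" using st by (meson abs_ge_zero order_trans)
    \<comment> \<open>With m + 1 agents beyond K' the potential energy alone would exceed the level just reached.\<close>
    have "card {i. \<bar>lap w p (\<lambda>j. e j t) i\<bar> > K'} \<le> m" if t: "s + T \<le> t" "t \<le> u" for t
    proof (rule ccontr)
      let ?A = "{i. \<bar>lap w p (\<lambda>j. e j t) i\<bar> > K'}"
      assume "\<not> card ?A \<le> m"
      hence c: "card ?A \<ge> Suc m" by simp
      hence ne: "?A \<noteq> {}" by (metis card.empty not_less_eq_eq zero_le)
      have "real (Suc m) * \<Phi> K' \<le> real (card ?A) * \<Phi> K'"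
        using c by (intro mult_right_mono potential_nonneg) simp
      also have "\<dots> = (\<Sum>i\<in>?A. \<Phi> K')" by simp
      also have "\<dots> < (\<Sum>i\<in>?A. \<Phi> (lap w p (\<lambda>j. e j t) i))"
        using ne K'0 by (intro sum_strict_mono potential_strict_mono) auto
      also have "\<dots> \<le> (\<Sum>i\<in>UNIV. \<Phi> (lap w p (\<lambda>j. e j t) i))"
        by (intro sum_mono2 potential_nonneg) auto
      also have "\<dots> \<le> energy (\<lambda>j. e j t) (\<lambda>j. d j t)"
        unfolding energy_def using dform_nonneg by simp
      also have "\<dots> \<le> energy (\<lambda>j. e j (s + T)) (\<lambda>j. d j (s + T))"
        by (rule energy_antimono[OF traj sT(2) t])
      finally show False using st by simp
    qed
    hence "energy (\<lambda>j. e j (s + T + T')) (\<lambda>j. d j (s + T + T')) \<le> 0"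
      using u st by (intro IH[OF trajectory_subinterval[OF traj sT(2) order_refl]]) auto
    thus ?thesis by (simp add: add.assoc)
  qed
  thus ?case using T T' by (intro exI[of _ "T + T'"]) auto
qed

lemma energy_bounded:
  "\<exists>E1. \<forall>e d. (\<forall>i. \<bar>e i\<bar> \<le> K \<and> \<bar>d i\<bar> \<le> K) \<longrightarrow> energy e d \<le> E1 \<and> (\<forall>i. \<bar>lap w p e i\<bar> \<le> E1)"
proof -
  obtain A where A: "A > 0" "\<And>x B i. (\<And>j. \<bar>x j\<bar> \<le> B) \<Longrightarrow> \<bar>lap w p x i\<bar> \<le> A * B"
    using lap_abs_bound[of w p] by blast
  define n where "n = real CARD('n)"
  define E1 where "E1 = \<bar>A * K\<bar> + n * \<Phi> (A * K) + n * (\<bar>K\<bar> * \<bar>A * K\<bar>)"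
  have n: "n \<ge> 0" by (simp add: n_def)
  have "energy e d \<le> E1 \<and> (\<forall>i. \<bar>lap w p e i\<bar> \<le> E1)" if "\<And>i. \<bar>e i\<bar> \<le> K \<and> \<bar>d i\<bar> \<le> K" for e d
  proof -
    have e: "\<bar>e i\<bar> \<le> K" and d: "\<bar>d i\<bar> \<le> K" for i using that by auto
    have y: "\<bar>lap w p e i\<bar> \<le> \<bar>A * K\<bar>" and z: "\<bar>lap w p d i\<bar> \<le> \<bar>A * K\<bar>" for i
      using A(2)[of e K i, OF e] A(2)[of d K i, OF d] by linarith+
    have "(\<Sum>i\<in>UNIV. \<Phi> (lap w p e i)) \<le> (\<Sum>i\<in>(UNIV :: 'n set). \<Phi> (A * K))"
      by (intro sum_mono potential_mono y)
    moreover have "dform w p d \<le> (\<Sum>i\<in>(UNIV :: 'n set). \<bar>K\<bar> * \<bar>A * K\<bar>)"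
      unfolding dform_def
    proof (rule sum_mono)
      fix i
      have "\<bar>d i * lap w p d i\<bar> \<le> \<bar>K\<bar> * \<bar>A * K\<bar>"
        unfolding abs_mult[of "d i"] using d[of i] z[of i] by (intro mult_mono) auto
      thus "d i * lap w p d i \<le> \<bar>K\<bar> * \<bar>A * K\<bar>" by linarith
    qed
    moreover have "n * (\<bar>K\<bar> * \<bar>A * K\<bar>) \<ge> 0" "n * \<Phi> (A * K) \<ge> 0"
      using n potential_nonneg by simp_all
    moreover have "\<bar>lap w p e i\<bar> \<le> E1" for i
      using calculation(3,4) y[of i] unfolding E1_def by linarith
    ultimately show ?thesis
      using dform_nonneg[of d] by (simp add: energy_def E1_def n_def)
  qed
  thus ?thesis by blast
qed

lemma energy_zero_imp:
  assumes "energy e d \<le> 0"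
  shows "e i = 0" "d i = 0"
proof -
  have P: "(\<Sum>i\<in>UNIV. \<Phi> (lap w p e i)) \<ge> 0" by (intro sum_nonneg potential_nonneg)
  have D: "dform w p d = 0" "(\<Sum>i\<in>UNIV. \<Phi> (lap w p e i)) = 0"
    using assms P dform_nonneg[of d] unfolding energy_def by linarith+
  obtain C where C: "C > 0" "\<And>x i. (x i)\<^sup>2 \<le> C * dform w p x" using coordinate_le_dform by blast
  show "d i = 0" using C(2)[of d i] D(1) by simp
  have "\<Phi> (lap w p e j) = 0" for j
    using D(2) potential_nonneg by (simp add: sum_nonneg_eq_0_iff)
  hence "lap w p e j = 0" for j
    using potential_strict_mono[of 0 "lap w p e j"] potential_0 by fastforce
  hence "dform w p e = 0" by (simp add: dform_def)
  thus "e i = 0" using C(2)[of e i] by simp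
qed

theorem finite_time_settling:
  "\<exists>T\<ge>0. \<forall>s u e d. trajectory (\<lambda>_ _. 0) s u e d \<longrightarrow> s + T \<le> u \<longrightarrow> (\<forall>i. \<bar>e i s\<bar> \<le> K \<and> \<bar>d i s\<bar> \<le> K) \<longrightarrow>
     (\<forall>t i. s + T \<le> t \<and> t \<le> u \<longrightarrow> e i t = 0 \<and> d i t = 0)"
proof -
  obtain E1 where E1: "\<And>e d. (\<forall>i. \<bar>e i\<bar> \<le> K \<and> \<bar>d i\<bar> \<le> K) \<Longrightarrow> energy e d \<le> E1 \<and> (\<forall>i. \<bar>lap w p e i\<bar> \<le> E1)"
    using energy_bounded[of K] by blast
  obtain T where T: "T \<ge> 0" and van: "\<And>s u e d. trajectory (\<lambda>_ _. 0) s u e d \<Longrightarrow> s + T \<le> u \<Longrightarrow>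
     energy (\<lambda>j. e j s) (\<lambda>j. d j s) \<le> E1 \<Longrightarrow> (\<forall>i. \<bar>lap w p (\<lambda>j. e j s) i\<bar> \<le> E1) \<Longrightarrow>
     (\<forall>t. s \<le> t \<and> t \<le> u \<longrightarrow> card {i. \<bar>lap w p (\<lambda>j. e j t) i\<bar> > E1} \<le> CARD('n)) \<Longrightarrow>
     energy (\<lambda>j. e j (s + T)) (\<lambda>j. d j (s + T)) \<le> 0"
    \<comment> \<open>With \<open>m = CARD('n)\<close> the condition on the number of large
      components is void, so any threshold would do in place of \<open>E1\<close>.\<close>
    using energy_vanishes[of E1 E1 E1 "CARD('n)"] by blast
  have "e i t = 0 \<and> d i t = 0"
    if traj: "trajectory (\<lambda>_ _. 0) s u e d" and u: "s + T \<le> u" and K: "\<forall>i. \<bar>e i s\<bar> \<le> K \<and> \<bar>d i s\<bar> \<le> K"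
      and t: "s + T \<le> t \<and> t \<le> u" for s u e d t i
  proof -
    have "energy (\<lambda>j. e j (s + T)) (\<lambda>j. d j (s + T)) \<le> 0"
      using E1[of "\<lambda>j. e j s" "\<lambda>j. d j s"] K by (intro van[OF traj u]) (auto intro: card_mono)
    moreover have "energy (\<lambda>j. e j t) (\<lambda>j. d j t) \<le> energy (\<lambda>j. e j (s + T)) (\<lambda>j. d j (s + T))"
      using t T by (intro energy_antimono[OF traj]) auto
    ultimately have "energy (\<lambda>j. e j t) (\<lambda>j. d j t) \<le> 0" by linarith
    thus ?thesis using energy_zero_imp[of "\<lambda>j. e j t" "\<lambda>j. d j t" i] by simp
  qed
  thus ?thesis using T by (intro exI[of _ T]) blast
qed

text \<open>Bridges the phase in which the estimator has not yet settled. The input power is at most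
  a multiple of the square root of the energy, hence of 1 plus the energy, and Gronwall's argument
  applies. Positions are then bounded by integrating the speed, since the energy does not control
  them.\<close>

lemma perturbed_bounded:
  assumes "T \<ge> 0" "B \<ge> 0"
  shows "\<exists>K'. \<forall>s b e d. trajectory b s (s + T) e d \<longrightarrow> (\<forall>i t. s \<le> t \<and> t < s + T \<longrightarrow> \<bar>b i t\<bar> \<le> B) \<longrightarrow>
     (\<forall>i. \<bar>e i s\<bar> \<le> K \<and> \<bar>d i s\<bar> \<le> K) \<longrightarrow> (\<forall>i. \<bar>e i (s + T)\<bar> \<le> K' \<and> \<bar>d i (s + T)\<bar> \<le> K')"
proof -
  obtain E1 where E1: "\<And>e d. (\<forall>i. \<bar>e i\<bar> \<le> K \<and> \<bar>d i\<bar> \<le> K) \<Longrightarrow> energy e d \<le> E1 \<and> (\<forall>i. \<bar>lap w p e i\<bar> \<le> E1)"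
    using energy_bounded[of K] by blast
  obtain C where C: "C > 0" "\<And>e d i. \<bar>d i\<bar> \<le> C * sqrt (energy e d)"
      "\<And>e d i. \<bar>lap w p d i\<bar> \<le> C * sqrt (energy e d)"
    using speed_le_energy by blast
  define n where "n = real CARD('n)"
  define \<kappa> where "\<kappa> = n * (C * B)"
  have kappa: "\<kappa> \<ge> 0" using C assms by (simp add: \<kappa>_def n_def)
  define E2 where "E2 = (1 + E1) * exp (\<kappa> * T)"
  define V where "V = C * sqrt \<bar>E2\<bar>"
  have V: "V \<ge> 0" using C by (simp add: V_def)
  have "\<bar>e i (s + T)\<bar> \<le> \<bar>K\<bar> + V * T + V \<and> \<bar>d i (s + T)\<bar> \<le> \<bar>K\<bar> + V * T + V"
    if traj: "trajectory b s (s + T) e d" and b: "\<And>i t. s \<le> t \<Longrightarrow> t < s + T \<Longrightarrow> \<bar>b i t\<bar> \<le> B"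
      and K: "\<And>i. \<bar>e i s\<bar> \<le> K \<and> \<bar>d i s\<bar> \<le> K" for s b e d i
  proof -
    define E where "E t = energy (\<lambda>j. e j t) (\<lambda>j. d j t)" for t
    have E0: "E t \<ge> 0" for t by (simp add: E_def energy_nonneg)
    have Es: "E s \<le> E1" using E1[of "\<lambda>j. e j s" "\<lambda>j. d j s"] K by (simp add: E_def)
    have Ebd: "E t \<le> E2" if t: "s \<le> t" "t \<le> s + T" for t
    proof -
      have tr: "trajectory b s t e d" using t by (intro trajectory_subinterval[OF traj]) auto
      define DE where "DE t = (\<Sum>i\<in>UNIV. lap w p (\<lambda>j. d j t) i * b i t)
        - (\<Sum>i\<in>UNIV. lap w p (\<lambda>j. d j t) i * h (lap w p (\<lambda>j. d j t) i))" for t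
      have DE: "DE t' \<le> \<kappa> * (1 + E t')" if t': "s \<le> t'" "t' < t" for t'
      proof -
        have "(\<Sum>i\<in>UNIV. lap w p (\<lambda>j. d j t') i * b i t') \<le> (\<Sum>i\<in>(UNIV::'n set). C * sqrt (E t') * B)"
        proof (rule sum_mono)
          fix i
          have "\<bar>lap w p (\<lambda>j. d j t') i * b i t'\<bar> \<le> C * sqrt (E t') * B"
            unfolding abs_mult using C(3)[of "\<lambda>j. d j t'" i "\<lambda>j. e j t'"] b[of t' i] t t' C(1) E0[of t']
            by (intro mult_mono) (auto simp: E_def)
          thus "lap w p (\<lambda>j. d j t') i * b i t' \<le> C * sqrt (E t') * B" by linarith
        qed
        also have "\<dots> = \<kappa> * sqrt (E t')" by (simp add: \<kappa>_def n_def)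
        also have "\<dots> \<le> \<kappa> * (1 + E t')"
        proof (rule mult_left_mono[OF _ kappa])
          have "2 * sqrt (E t') \<le> 1 + (sqrt (E t'))\<^sup>2"
            using zero_le_power2[of "sqrt (E t') - 1"] by (simp add: power2_eq_square algebra_simps)
          thus "sqrt (E t') \<le> 1 + E t'" using E0[of t'] by (simp add: real_sqrt_ge_zero) 
        qed
        finally show ?thesis unfolding DE_def
          using sum_nonneg[of UNIV "\<lambda>i. lap w p (\<lambda>j. d j t') i * h (lap w p (\<lambda>j. d j t') i)"] h_nonneg
          by auto
      qed
      define G where "G t = (1 + E t) * exp (- \<kappa> * (t - s))" for t
      have "G t \<le> G s + 0 * (t - s)"
      proof (rule right_derivative_upper_bound[OF t(1)])
        show "continuous_on {s..t} G" unfolding G_def E_def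
          by (intro continuous_intros continuous_on_energy[OF tr])
        show "(G has_real_derivative (DE t' - \<kappa> * (1 + E t')) * exp (- \<kappa> * (t' - s))) (at t' within {t'..})"
          if "s \<le> t'" "t' < t" for t'
        proof -
          have "(E has_real_derivative DE t') (at t' within {t'..})"
            using energy_derivative[OF tr that] unfolding E_def DE_def .
          thus ?thesis unfolding G_def by (auto intro!: derivative_eq_intros simp: algebra_simps)
        qed
        show "(DE t' - \<kappa> * (1 + E t')) * exp (- \<kappa> * (t' - s)) \<le> 0" if "s \<le> t'" "t' < t" for t'
          using DE[OF that] by (simp add: mult_le_0_iff)
      qed
      hence "(1 + E t) * exp (- (\<kappa> * (t - s))) \<le> 1 + E s" by (simp add: G_def)
      hence "(1 + E t) / exp (\<kappa> * (t - s)) \<le> 1 + E s" by (simp only: exp_minus divide_inverse)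
      hence "1 + E t \<le> (1 + E s) * exp (\<kappa> * (t - s))" by (simp only: pos_divide_le_eq exp_gt_zero)
      also have "\<dots> \<le> (1 + E1) * exp (\<kappa> * T)"
        using Es E0[of s] kappa t by (intro mult_mono) (auto intro: mult_left_mono)
      finally show ?thesis by (simp add: E2_def)
    qed
    have dbd: "\<bar>d i t\<bar> \<le> V" if t: "s \<le> t" "t \<le> s + T" for t
    proof -
      have "C * sqrt (E t) \<le> V" unfolding V_def using Ebd[OF t] C(1) by simp
      thus ?thesis using C(2)[of "\<lambda>j. d j t" i "\<lambda>j. e j t"] by (simp add: E_def)
    qed
    have "\<bar>e i (s + T)\<bar> \<le> \<bar>e i s\<bar> + V * (s + T - s)"
      using traj assms dbd unfolding trajectory_def
      by (intro right_derivative_displacement[where D = "d i"]) auto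
    moreover have "\<bar>d i (s + T)\<bar> \<le> V" using dbd[of "s + T"] assms by simp
    moreover have "\<bar>e i s\<bar> \<le> K" using K by blast
    moreover have "V * T \<ge> 0" using V assms by simp
    ultimately show ?thesis using V by simp
  qed
  thus ?thesis by (intro exI[of _ "\<bar>K\<bar> + V * T + V"]) blast
qed

end

section \<open>The sign-based acceleration estimator\<close>

lemma has_integral_bound_off_negligible:
  fixes g :: "real \<Rightarrow> real"
  assumes "(g has_integral I) {s..t}" "s \<le> t" "negligible N" "B \<ge> 0"
    and "\<And>x. s \<le> x \<Longrightarrow> x \<le> t \<Longrightarrow> x \<notin> N \<Longrightarrow> \<bar>g x\<bar> \<le> B"
  shows "\<bar>I\<bar> \<le> B * (t - s)"
proof -
  have "((\<lambda>x. if x \<in> N then 0 else g x) has_integral I) {s..t}"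
    by (rule has_integral_spike[OF assms(3) _ assms(1)]) auto
  from has_integral_bound_real[OF assms(4) finite.emptyI this] assms(2,4,5)
  show ?thesis by auto
qed

lemma has_integral_const_off_negligible:
  fixes g :: "real \<Rightarrow> real"
  assumes "(g has_integral I) {s..t}" "s \<le> t" "negligible N"
    and "\<And>x. s \<le> x \<Longrightarrow> x \<le> t \<Longrightarrow> x \<notin> N \<Longrightarrow> g x = c"
  shows "I = c * (t - s)"
proof -
  have "((\<lambda>x. c) has_integral I) {s..t}"
    by (rule has_integral_spike[OF assms(3) _ assms(1)]) (use assms(4) in auto)
  moreover have "((\<lambda>x. c) has_integral c * (t - s)) {s..t}"
    using has_integral_const_real[of c s t] assms(2) by (simp add: mult.commute)
  ultimately show ?thesis by (rule has_integral_unique)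
qed

context pinned_graph
begin

text \<open>Each \<open>a i\<close> is only Lipschitz and may lack a one-sided derivative where the
  sign is set-valued. The quadratic form still has one: there the factor of the undetermined
  difference quotient tends to 0, so the selection made from \<open>SGN\<close> leaves no trace in
  the result.\<close>

lemma estimator_derivative:
  assumes a_int: "\<And>i t. t \<ge> t0 \<Longrightarrow> (da i has_integral (a i t - a i t0)) {t0..t}"
    and a_incl: "\<And>i. AE t in lebesgue. t \<ge> t0 \<longrightarrow> da i t \<in> (\<lambda>x. - \<beta> * x) ` SGN (lap w p (\<lambda>j. a j t - r t) i)"
    and r_der: "\<And>t. t \<ge> t0 \<Longrightarrow> (r has_real_derivative dr t) (at t within {t0..})"
    and beta: "\<beta> > 0"
  defines "V \<equiv> \<lambda>t. dform w p (\<lambda>j. a j t - r t) / 2"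
  shows "continuous_on {t0..} V"
    and "s \<ge> t0 \<Longrightarrow> (V has_real_derivative
      (\<Sum>i\<in>UNIV. - \<beta> * \<bar>lap w p (\<lambda>j. a j s - r s) i\<bar> - dr s * lap w p (\<lambda>j. a j s - r s) i)) (at s within {s..})"
proof -
  define b where "b i t = a i t - r t" for i t
  define y where "y i t = lap w p (\<lambda>j. b j t) i" for i t
  have "\<exists>N. negligible N \<and> (\<forall>t. t \<ge> t0 \<longrightarrow> t \<notin> N \<longrightarrow> da i t \<in> (\<lambda>x. - \<beta> * x) ` SGN (y i t))" for i
  proof (rule AE_E3[OF a_incl[of i]])
    fix N
    assume N: "\<And>t. t \<in> space lebesgue - N \<Longrightarrow>
        t \<ge> t0 \<longrightarrow> da i t \<in> (\<lambda>x. - \<beta> * x) ` SGN (lap w p (\<lambda>j. a j t - r t) i)"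
      "N \<in> null_sets lebesgue"
    show ?thesis
    proof (intro exI[of _ N] conjI allI impI)
      show "negligible N" using N(2) by (simp add: negligible_iff_null_sets)
      show "da i t \<in> (\<lambda>x. - \<beta> * x) ` SGN (y i t)" if "t \<ge> t0" "t \<notin> N" for t
        unfolding y_def b_def using N(1)[of t] that by simp
    qed
  qed
  then obtain N where N: "\<And>i. negligible (N i)"
    "\<And>i t. t \<ge> t0 \<Longrightarrow> t \<notin> N i \<Longrightarrow> da i t \<in> (\<lambda>x. - \<beta> * x) ` SGN (y i t)" by metis
  have a_diff: "(da i has_integral (a i t - a i s)) {s..t}" if "t0 \<le> s" "s \<le> t" for i s t
  proof -
    have "da i integrable_on {s..t}"
      by (rule integrable_subinterval_real[of _ t0 t]) (use a_int[of t i] that in auto)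
    then obtain I where I: "(da i has_integral I) {s..t}" by blast
    have "(da i has_integral (a i s - a i t0) + I) {t0..t}"
      using has_integral_combine[OF that a_int[of s i] I] that by simp
    hence "(a i s - a i t0) + I = a i t - a i t0"
      using a_int[of t i] that by (meson has_integral_unique order_trans)
    hence "I = a i t - a i s" by simp
    thus ?thesis using I by simp
  qed
  have a_lip: "\<bar>a i t - a i s\<bar> \<le> \<beta> * (t - s)" if "t0 \<le> s" "s \<le> t" for i s t
  proof (rule has_integral_bound_off_negligible[OF a_diff[OF that] that(2) N(1)])
    show "\<bar>da i x\<bar> \<le> \<beta>" if x: "s \<le> x" "x \<le> t" "x \<notin> N i" for x
    proof -
      obtain v where "v \<in> SGN (y i x)" "da i x = - \<beta> * v" using N(2)[of x i] x \<open>t0 \<le> s\<close> by auto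
      moreover have "\<bar>v\<bar> \<le> 1" using \<open>v \<in> SGN (y i x)\<close> by (auto simp: SGN_def split: if_splits)
      ultimately show ?thesis using beta by (simp add: abs_mult)
    qed
  qed (use beta in auto)
  have a_cont: "continuous_on {t0..} (a i)" for i
  proof -
    have "\<beta>-lipschitz_on {t0..} (a i)"
    proof (rule lipschitz_onI)
      show "dist (a i x) (a i z) \<le> \<beta> * dist x z" if "x \<in> {t0..}" "z \<in> {t0..}" for x z
        using a_lip[of x z i] a_lip[of z x i] that by (cases "x \<le> z") (auto simp: dist_real_def abs_minus_commute)
    qed (use beta in simp)
    thus ?thesis by (rule lipschitz_on_continuous_on)
  qed
  have r_cont: "continuous_on {t0..} r" using r_der by (meson DERIV_continuous_on atLeast_iff)
  have b_cont: "continuous_on {t0..} (b i)" for i unfolding b_def by (intro continuous_intros a_cont r_cont)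
  have y_cont: "continuous_on {t0..} (y i)" for i unfolding y_def by (intro continuous_on_lap b_cont)
  have V_eq: "V t = (\<Sum>i\<in>UNIV. b i t * y i t) / 2" for t by (simp add: V_def dform_def y_def b_def)
  show "continuous_on {t0..} V" unfolding V_eq by (intro continuous_intros b_cont y_cont) simp
  assume s: "s \<ge> t0"
  have y_lim: "(y i \<longlongrightarrow> y i s) (at s within {s..})" for i
  proof -
    have "(y i \<longlongrightarrow> y i s) (at s within {t0..})" using y_cont[of i] s by (auto simp: continuous_on_def)
    thus ?thesis by (rule tendsto_within_subset) (use s in auto)
  qed
  have avg_lim: "((\<lambda>t. (y i t + y i s) / 2) \<longlongrightarrow> y i s) (at s within {s..})" for i
    using tendsto_divide[OF tendsto_add[OF y_lim[of i] tendsto_const[of "y i s"]] tendsto_const[of 2]] by simp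
  have r_quot: "((\<lambda>t. (r t - r s) / (t - s)) \<longlongrightarrow> dr s) (at s within {s..})"
  proof -
    have "(r has_real_derivative dr s) (at s within {s..})"
      by (rule has_field_derivative_subset[OF r_der[OF s]]) (use s in auto)
    thus ?thesis by (simp add: has_field_derivative_iff)
  qed
  have constant_rate: "((\<lambda>t. (a i t - a i s) / (t - s)) \<longlongrightarrow> - \<beta> * sgn (y i s)) (at s within {s..})"
    if nz: "y i s \<noteq> 0" for i
  proof -
    have "eventually (\<lambda>t. sgn (y i t) = sgn (y i s)) (at s within {t0..})"
    proof -
      have lim: "(y i \<longlongrightarrow> y i s) (at s within {t0..})" using y_cont[of i] s by (auto simp: continuous_on_def)
      show ?thesis
      proof (cases "y i s > 0")
        case True
        show ?thesis using order_tendstoD(1)[OF lim True] by eventually_elim (use True in auto)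
      next
        case False
        hence neg: "y i s < 0" using nz by simp
        show ?thesis using order_tendstoD(2)[OF lim neg] by eventually_elim (use neg in auto)
      qed
    qed
    then obtain \<delta> where d: "\<delta> > 0" "\<And>t. t \<ge> t0 \<Longrightarrow> t \<noteq> s \<Longrightarrow> \<bar>t - s\<bar> < \<delta> \<Longrightarrow> sgn (y i t) = sgn (y i s)"
      unfolding eventually_at dist_real_def by auto
    have sg: "sgn (y i t) = sgn (y i s)" if "t \<ge> s" "t < s + \<delta>" for t
      using d(2)[of t] that s by (cases "t = s") auto
    have "(a i t - a i s) / (t - s) = - \<beta> * sgn (y i s)" if t: "t > s" "t < s + \<delta>" for t
    proof -
      have "a i t - a i s = - \<beta> * sgn (y i s) * (t - s)"
      proof (rule has_integral_const_off_negligible[OF a_diff[OF s] _ N(1)])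
        show "da i x = - \<beta> * sgn (y i s)" if x: "s \<le> x" "x \<le> t" "x \<notin> N i" for x
        proof -
          have sx: "sgn (y i x) = sgn (y i s)" using sg[of x] x t by simp
          hence "y i x \<noteq> 0" using nz by (metis sgn_0_0)
          hence "SGN (y i x) = {sgn (y i x)}" by (auto simp: SGN_def)
          thus ?thesis using N(2)[of x i] x s sx by auto
        qed
      qed (use t in auto)
      thus ?thesis using t by simp
    qed
    hence "eventually (\<lambda>t. (a i t - a i s) / (t - s) = - \<beta> * sgn (y i s)) (at s within {s..})"
      unfolding eventually_at dist_real_def using d(1) by (intro exI[of _ \<delta>]) auto
    thus ?thesis by (rule tendsto_eventually)
  qed
  have term_lim: "((\<lambda>t. (a i t - a i s) / (t - s) * ((y i t + y i s) / 2)) \<longlongrightarrow> - \<beta> * \<bar>y i s\<bar>) (at s within {s..})" for i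
  proof (cases "y i s = 0")
    case False
    have eq: "- \<beta> * sgn (y i s) * y i s = - \<beta> * \<bar>y i s\<bar>" by (simp add: abs_sgn)
    show ?thesis using tendsto_mult[OF constant_rate[OF False] avg_lim[of i]] unfolding eq .
  next
    case True
    have "((\<lambda>t. \<beta> * \<bar>(y i t + y i s) / 2\<bar>) \<longlongrightarrow> \<beta> * \<bar>y i s\<bar>) (at s within {s..})"
      by (intro tendsto_intros avg_lim)
    hence lim0: "((\<lambda>t. \<beta> * \<bar>(y i t + y i s) / 2\<bar>) \<longlongrightarrow> 0) (at s within {s..})" using True by simp
    have "eventually (\<lambda>t. norm ((a i t - a i s) / (t - s) * ((y i t + y i s) / 2)) \<le> \<beta> * \<bar>(y i t + y i s) / 2\<bar>) (at s within {s..})"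
      unfolding eventually_at
    proof (intro exI[of _ 1] conjI ballI impI)
      fix t assume t: "t \<in> {s..}" "t \<noteq> s \<and> dist t s < 1"
      hence "\<bar>(a i t - a i s) / (t - s)\<bar> \<le> \<beta>" using a_lip[OF s, of t i] by (simp add: abs_divide pos_divide_le_eq)
      thus "norm ((a i t - a i s) / (t - s) * ((y i t + y i s) / 2)) \<le> \<beta> * \<bar>(y i t + y i s) / 2\<bar>"
        unfolding real_norm_def abs_mult[of "(a i t - a i s) / (t - s)"] by (intro mult_right_mono) auto
    qed simp
    moreover have "- \<beta> * \<bar>y i s\<bar> = 0" using True by simp
    ultimately show ?thesis using Lim_null_comparison[OF _ lim0] by (simp only:)
  qed
  \<comment> \<open>For a symmetric form the increment of \<open>V\<close> is exactly the increment
    of \<open>b\<close> paired with the average of both values of \<open>y\<close>. Difference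
    quotients of \<open>a\<close> thus meet only continuous factors.\<close>
  have quot: "(V t - V s) / (t - s) = (\<Sum>i\<in>UNIV. (a i t - a i s) / (t - s) * ((y i t + y i s) / 2)
      - (r t - r s) / (t - s) * ((y i t + y i s) / 2))" for t
  proof -
    have "(\<Sum>i\<in>UNIV. b i t * y i s) = (\<Sum>i\<in>UNIV. b i s * y i t)"
      unfolding y_def by (rule lap_self_adjoint)
    moreover have "2 * (\<Sum>i\<in>UNIV. (b i t - b i s) * ((y i t + y i s) / 2))
       = (\<Sum>i\<in>UNIV. b i t * y i t + b i t * y i s - b i s * y i t - b i s * y i s)"
      unfolding sum_distrib_left by (intro sum.cong refl) (simp add: field_simps)
    ultimately have "V t - V s = (\<Sum>i\<in>UNIV. (b i t - b i s) * ((y i t + y i s) / 2))"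
      unfolding V_eq by (simp add: sum.distrib sum_subtractf)
    hence "(V t - V s) / (t - s) = (\<Sum>i\<in>UNIV. (b i t - b i s) * ((y i t + y i s) / 2) / (t - s))"
      by (simp add: sum_divide_distrib)
    also have "\<dots> = (\<Sum>i\<in>UNIV. (a i t - a i s) / (t - s) * ((y i t + y i s) / 2)
      - (r t - r s) / (t - s) * ((y i t + y i s) / 2))"
      by (intro sum.cong refl) (simp only: b_def left_diff_distrib diff_divide_distrib times_divide_eq_left)
    finally show ?thesis .
  qed
  have "((\<lambda>t. (V t - V s) / (t - s)) \<longlongrightarrow> (\<Sum>i\<in>UNIV. - \<beta> * \<bar>y i s\<bar> - dr s * y i s)) (at s within {s..})"
    unfolding quot by (intro tendsto_sum tendsto_diff term_lim tendsto_mult r_quot avg_lim)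
  thus "(V has_real_derivative (\<Sum>i\<in>UNIV. - \<beta> * \<bar>lap w p (\<lambda>j. a j s - r s) i\<bar>
      - dr s * lap w p (\<lambda>j. a j s - r s) i)) (at s within {s..})"
    by (simp add: has_field_derivative_iff y_def b_def)
qed

text \<open>A Filippov solution: \<open>a\<close> is an indefinite integral of \<open>da\<close>,
  and the inclusion is demanded almost everywhere only. The scalar form lets each coordinate of the
  vector estimator be treated separately.\<close>

definition estimator_run ::
    "real \<Rightarrow> real \<Rightarrow> real \<Rightarrow> ('n \<Rightarrow> real \<Rightarrow> real) \<Rightarrow> ('n \<Rightarrow> real \<Rightarrow> real) \<Rightarrow> (real \<Rightarrow> real) \<Rightarrow> (real \<Rightarrow> real) \<Rightarrow> bool"
  where
  "estimator_run \<beta> M t0 a da r dr \<longleftrightarrow>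
     (\<forall>i t. t \<ge> t0 \<longrightarrow> (da i has_integral (a i t - a i t0)) {t0..t}) \<and>
     (\<forall>i. AE t in lebesgue. t \<ge> t0 \<longrightarrow> da i t \<in> (\<lambda>x. - \<beta> * x) ` SGN (lap w p (\<lambda>j. a j t - r t) i)) \<and>
     (\<forall>t\<ge>t0. (r has_real_derivative dr t) (at t within {t0..}) \<and> \<bar>dr t\<bar> \<le> M)"

text \<open>The margin between \<beta> and \<open>M\<close> makes \<open>V\<close> fall at a rate
  proportional to the l1 norm of \<open>y\<close>, hence at least proportional to sqrt V. So sqrt V
  falls at least linearly until it reaches 0.\<close>

theorem estimator_settling:
  assumes beta: "\<beta> > 0" and M: "M < \<beta>"
  shows "\<exists>T\<ge>0. \<exists>B\<ge>0. \<forall>t0 a da r dr.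
     estimator_run \<beta> M t0 a da r dr \<longrightarrow>
     (\<forall>i. \<bar>a i t0 - r t0\<bar> \<le> K) \<longrightarrow>
     (\<forall>i t. t \<ge> t0 \<longrightarrow> \<bar>a i t - r t\<bar> \<le> B) \<and> (\<forall>i t. t \<ge> t0 + T \<longrightarrow> a i t = r t)"
proof -
  obtain C where C: "C > 0" "\<And>x i. (x i)\<^sup>2 \<le> C * dform w p x" using coordinate_le_dform by blast
  obtain D where D: "D > 0" "\<And>x. dform w p x \<le> D * (\<Sum>i\<in>UNIV. (lap w p x i)\<^sup>2)" using dform_le_lap by blast
  obtain A where A: "A > 0" "\<And>x B i. (\<And>j. \<bar>x j\<bar> \<le> B) \<Longrightarrow> \<bar>lap w p x i\<bar> \<le> A * B"
    using lap_abs_bound[of w p] by blast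
  define V1 where "V1 = real CARD('n) * (\<bar>K\<bar> * (A * \<bar>K\<bar>)) / 2"
  have V1: "V1 \<ge> 0" using A by (simp add: V1_def)
  \<comment> \<open>The rate at which sqrt V falls: \<open>sqrt (D / 2)\<close> compares sqrt V with
    the l1 norm of \<open>y\<close>, and the 2 comes from differentiating the square root.\<close>
  define k where "k = (\<beta> - M) / (2 * sqrt (D / 2))"
  have k: "k > 0" using M D by (simp add: k_def)
  \<comment> \<open>The extra 1 pushes the linear bound for sqrt V down to \<open>- k\<close>, which
    is absurd if \<open>V\<close> is still positive.\<close>
  define T where "T = sqrt V1 / k + 1"
  define B where "B = sqrt (C * (2 * V1))"
  have T: "T \<ge> 0" using V1 k by (simp add: T_def)
  have B: "B \<ge> 0" using V1 C by (simp add: B_def)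
  have "(\<forall>i t. t \<ge> t0 \<longrightarrow> \<bar>a i t - r t\<bar> \<le> B) \<and> (\<forall>i t. t \<ge> t0 + T \<longrightarrow> a i t = r t)"
    if run: "estimator_run \<beta> M t0 a da r dr" and K: "\<And>i. \<bar>a i t0 - r t0\<bar> \<le> K" for t0 a da r dr
  proof -
    have a_int: "(da i has_integral (a i t - a i t0)) {t0..t}" if "t \<ge> t0" for i t
      using run that unfolding estimator_run_def by blast
    have a_incl: "AE t in lebesgue. t \<ge> t0 \<longrightarrow> da i t \<in> (\<lambda>x. - \<beta> * x) ` SGN (lap w p (\<lambda>j. a j t - r t) i)" for i
      using run unfolding estimator_run_def by blast
    have r_der: "(r has_real_derivative dr t) (at t within {t0..}) \<and> \<bar>dr t\<bar> \<le> M" if "t \<ge> t0" for t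
      using run that unfolding estimator_run_def by blast
    define V where "V t = dform w p (\<lambda>j. a j t - r t) / 2" for t
    define y where "y i t = lap w p (\<lambda>j. a j t - r t) i" for i t
    define DV where "DV t = (\<Sum>i\<in>UNIV. - \<beta> * \<bar>y i t\<bar> - dr t * y i t)" for t
    have r_der': "(r has_real_derivative dr t) (at t within {t0..})" if "t \<ge> t0" for t using r_der that by blast
    have V_cont: "continuous_on {t0..} V"
      using estimator_derivative(1)[of t0 da a \<beta> r dr, OF a_int a_incl r_der' beta] unfolding V_def .
    have V_der: "(V has_real_derivative DV t) (at t within {t..})" if "t \<ge> t0" for t
      using estimator_derivative(2)[of t0 da a \<beta> r dr, OF a_int a_incl r_der' beta that] unfolding V_def DV_def y_def .
    have V0: "V t \<ge> 0" for t by (simp add: V_def dform_nonneg)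
    have DV: "DV t \<le> - (\<beta> - M) * (\<Sum>i\<in>UNIV. \<bar>y i t\<bar>)" if t: "t \<ge> t0" for t
    proof -
      have "DV t \<le> (\<Sum>i\<in>UNIV. - (\<beta> - M) * \<bar>y i t\<bar>)"
        unfolding DV_def
      proof (rule sum_mono)
        fix i
        have "\<bar>dr t * y i t\<bar> \<le> M * \<bar>y i t\<bar>"
          unfolding abs_mult using r_der[OF t] by (intro mult_right_mono) auto
        thus "- \<beta> * \<bar>y i t\<bar> - dr t * y i t \<le> - (\<beta> - M) * \<bar>y i t\<bar>" by (simp add: left_diff_distrib)
      qed
      thus ?thesis by (simp add: sum_distrib_left)
    qed
    have DV0: "DV t \<le> 0" if "t \<ge> t0" for t
    proof -
      have "(\<beta> - M) * (\<Sum>i\<in>UNIV. \<bar>y i t\<bar>) \<ge> 0" using M by (intro mult_nonneg_nonneg sum_nonneg) auto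
      thus ?thesis using DV[OF that] unfolding mult_minus_left by linarith
    qed
    have V_mono: "V t' \<le> V t" if "t0 \<le> t" "t \<le> t'" for t t'
    proof -
      have "V t' \<le> V t + 0 * (t' - t)"
        using that by (intro right_derivative_upper_bound[OF that(2) _ V_der] continuous_on_subset[OF V_cont] DV0) auto
      thus ?thesis by simp
    qed
    have Vt0: "V t0 \<le> V1"
    proof -
      have "dform w p (\<lambda>j. a j t0 - r t0) \<le> (\<Sum>i\<in>(UNIV::'n set). \<bar>K\<bar> * (A * \<bar>K\<bar>))"
        unfolding dform_def
      proof (rule sum_mono)
        fix i
        have K': "\<bar>a j t0 - r t0\<bar> \<le> \<bar>K\<bar>" for j using K[of j] by linarith
        have "\<bar>(a i t0 - r t0) * lap w p (\<lambda>j. a j t0 - r t0) i\<bar> \<le> \<bar>K\<bar> * (A * \<bar>K\<bar>)"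
          unfolding abs_mult[of "a i t0 - r t0"] using K' A(2)[of "\<lambda>j. a j t0 - r t0", OF K'] by (intro mult_mono) auto
        thus "(a i t0 - r t0) * lap w p (\<lambda>j. a j t0 - r t0) i \<le> \<bar>K\<bar> * (A * \<bar>K\<bar>)" by linarith
      qed
      thus ?thesis by (simp add: V_def V1_def)
    qed
    have bnd: "\<bar>a i t - r t\<bar> \<le> B" if t: "t \<ge> t0" for i t
    proof -
      have "(a i t - r t)\<^sup>2 \<le> C * (2 * V t)" using C(2)[of "\<lambda>j. a j t - r t" i] by (simp add: V_def)
      also have "\<dots> \<le> C * (2 * V1)" using V_mono[OF order_refl t] Vt0 C(1) by (intro mult_left_mono) auto
      finally have "sqrt ((a i t - r t)\<^sup>2) \<le> B" unfolding B_def by (rule real_sqrt_le_mono)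
      thus ?thesis by simp
    qed
    have "V t1 = 0" if t1: "t1 \<ge> t0 + T" for t1
    proof (rule ccontr)
      assume "V t1 \<noteq> 0"
      hence pos1: "V t1 > 0" using V0[of t1] by simp
      have t01: "t0 \<le> t1" using t1 T by simp
      have pos: "V t > 0" if "t0 \<le> t" "t \<le> t1" for t using V_mono[OF that] pos1 by simp
      have "sqrt (V t1) \<le> sqrt (V t0) + (- k) * (t1 - t0)"
      proof (rule right_derivative_upper_bound[OF t01])
        show "continuous_on {t0..t1} (\<lambda>t. sqrt (V t))"
          by (intro continuous_intros continuous_on_subset[OF V_cont]) auto
        show "((\<lambda>t. sqrt (V t)) has_real_derivative inverse (sqrt (V t)) / 2 * DV t) (at t within {t..})"
          if "t0 \<le> t" "t < t1" for t
          using pos[of t] that by (intro DERIV_chain2[OF DERIV_real_sqrt V_der]) auto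
        show "inverse (sqrt (V t)) / 2 * DV t \<le> - k" if t: "t0 \<le> t" "t < t1" for t
        proof -
          have Vp: "sqrt (V t) > 0" using pos[of t] t by simp
          have "(\<Sum>i\<in>UNIV. (y i t)\<^sup>2) \<le> (\<Sum>i\<in>UNIV. \<bar>y i t\<bar>)\<^sup>2"
          proof -
            have "(\<Sum>i\<in>UNIV. (y i t)\<^sup>2) \<le> (\<Sum>i\<in>UNIV. \<bar>y i t\<bar> * (\<Sum>i\<in>UNIV. \<bar>y i t\<bar>))"
            proof (rule sum_mono)
              fix i
              have "\<bar>y i t\<bar> \<le> (\<Sum>i\<in>UNIV. \<bar>y i t\<bar>)" by (intro member_le_sum) auto
              hence "\<bar>y i t\<bar> * \<bar>y i t\<bar> \<le> \<bar>y i t\<bar> * (\<Sum>i\<in>UNIV. \<bar>y i t\<bar>)" by (intro mult_left_mono) auto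
              thus "(y i t)\<^sup>2 \<le> \<bar>y i t\<bar> * (\<Sum>i\<in>UNIV. \<bar>y i t\<bar>)" by (simp add: power2_eq_square)
            qed
            thus ?thesis by (simp add: power2_eq_square sum_distrib_right)
          qed
          hence "D * (\<Sum>i\<in>UNIV. (y i t)\<^sup>2) \<le> D * (\<Sum>i\<in>UNIV. \<bar>y i t\<bar>)\<^sup>2" using D(1) by simp
          hence "V t \<le> D / 2 * (\<Sum>i\<in>UNIV. \<bar>y i t\<bar>)\<^sup>2"
            using D(2)[of "\<lambda>j. a j t - r t"] unfolding V_def y_def by simp
          hence "sqrt (V t) \<le> sqrt (D / 2 * (\<Sum>i\<in>UNIV. \<bar>y i t\<bar>)\<^sup>2)" by (rule real_sqrt_le_mono)
          also have "\<dots> = sqrt (D / 2) * (\<Sum>i\<in>UNIV. \<bar>y i t\<bar>)"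
            by (simp only: real_sqrt_mult real_sqrt_abs) (simp add: sum_nonneg abs_of_nonneg)
          finally have sq: "sqrt (V t) \<le> sqrt (D / 2) * (\<Sum>i\<in>UNIV. \<bar>y i t\<bar>)" .
          have "2 * k * sqrt (V t) \<le> 2 * k * (sqrt (D / 2) * (\<Sum>i\<in>UNIV. \<bar>y i t\<bar>))"
            using sq k by (intro mult_left_mono) auto
          also have "\<dots> = (\<beta> - M) * (\<Sum>i\<in>UNIV. \<bar>y i t\<bar>)" using D(1) by (simp add: k_def)
          finally have "DV t \<le> - (2 * k * sqrt (V t))" using DV[of t] t unfolding mult_minus_left by linarith
          hence "inverse (sqrt (V t)) / 2 * DV t \<le> inverse (sqrt (V t)) / 2 * (- (2 * k * sqrt (V t)))"
            using Vp by (intro mult_left_mono) auto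
          also have "\<dots> = - k" using Vp by simp
          finally show ?thesis .
        qed
      qed
      moreover have "k * (t1 - t0) \<ge> k * T" using t1 k by simp
      moreover have "k * T = sqrt V1 + k" using k by (simp add: T_def distrib_left)
      moreover have "sqrt (V t0) \<le> sqrt V1" using Vt0 by simp
      ultimately have "sqrt (V t1) \<le> - k" unfolding mult_minus_left by linarith
      thus False using k pos1 by (smt (verit) real_sqrt_gt_zero)
    qed
    hence "a i t = r t" if "t \<ge> t0 + T" for i t
      using C(2)[of "\<lambda>j. a j t - r t" i] that by (simp add: V_def)
    thus ?thesis using bnd by blast
  qed
  thus ?thesis using T B by (intro exI[of _ T] conjI exI[of _ B]) blast+
qed

end

section \<open>Switching formations\<close>

theorem theorem1:
  fixes H :: "'n::finite \<Rightarrow> real^'m::finite \<Rightarrow> real^'m^'m"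
    and C :: "'n \<Rightarrow> real^'m \<Rightarrow> real^'m \<Rightarrow> real^'m^'m"
    and g :: "'n \<Rightarrow> real^'m \<Rightarrow> real^'m"
    and w :: "'n \<Rightarrow> 'n \<Rightarrow> real"
    and p :: "'n \<Rightarrow> real"
    and t0 \<beta> \<alpha>1 \<alpha>2 R :: real
    and \<phi> \<psi> :: "real \<Rightarrow> real"
    and x0 v0 a0 da0 :: "real \<Rightarrow> real^'m"
    and k :: nat
    and F :: "nat \<Rightarrow> 'n \<Rightarrow> real^'m"
  assumes H_spd: "\<And>i x. transpose (H i x) = H i x \<and> (\<forall>v. v \<noteq> 0 \<longrightarrow> v \<bullet> (H i x *v v) > 0)"
    and w_sym: "\<And>i j. w i j = w j i"
    and w_nonneg: "\<And>i j. w i j \<ge> 0"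
    and w_diag: "\<And>i. w i i = 0"
    and p_nonneg: "\<And>i. p i \<ge> 0"
    and A1: "leader_reachable w p"
    and beta_pos: "\<beta> > 0"
    and A2: "\<exists>M<\<beta>. \<forall>t\<ge>t0. norm (da0 t) \<le> M"
    and leader_x: "\<And>t. t \<ge> t0 \<Longrightarrow> (x0 has_vector_derivative v0 t) (at t within {t0..})"
    and leader_v: "\<And>t. t \<ge> t0 \<Longrightarrow> (v0 has_vector_derivative a0 t) (at t within {t0..})"
    and leader_a: "\<And>t. t \<ge> t0 \<Longrightarrow> (a0 has_vector_derivative da0 t) (at t within {t0..})"
    and leader_a_C1: "continuous_on {t0..} da0"
    and phi: "admissible_fun \<phi>"
    and psi: "admissible_fun \<psi>"
    and formations: "\<And>r. r \<le> k \<Longrightarrow> (\<Sum>i\<in>UNIV. F r i) = 0"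
    and alpha1: "0 < \<alpha>1" "\<alpha>1 < 1"
    and alpha2: "\<alpha>2 = 2 * \<alpha>1 / (\<alpha>1 + 1)"
    and R_pos: "R > 0"
  shows "\<exists>T>0. \<forall>(ts :: nat \<Rightarrow> real) (\<sigma> :: nat \<Rightarrow> nat)
            (q :: 'n \<Rightarrow> real \<Rightarrow> real^'m) (dq :: 'n \<Rightarrow> real \<Rightarrow> real^'m)
            (ddq :: 'n \<Rightarrow> real \<Rightarrow> real^'m) (a :: 'n \<Rightarrow> real \<Rightarrow> real^'m)
            (da :: 'n \<Rightarrow> real \<Rightarrow> real^'m) (tau :: 'n \<Rightarrow> real \<Rightarrow> real^'m).
    ( strict_mono ts \<and> ts 0 = t0 \<and> (\<forall>s. ts (Suc s) - ts s \<ge> T) \<and> (\<forall>s. \<sigma> s \<le> k)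
    \<and> (\<forall>i. norm (q i t0) \<le> R \<and> norm (dq i t0) \<le> R \<and> norm (a i t0) \<le> R)
    \<and> (\<forall>i t. t \<ge> t0 \<longrightarrow> (q i has_vector_derivative dq i t) (at t within {t0..}))
    \<and> (\<forall>i. continuous_on {t0..} (dq i))
    \<and> (\<forall>i t. t \<ge> t0 \<longrightarrow> (dq i has_vector_derivative ddq i t) (at t within {t..}))
    \<and> (\<forall>i t. t \<ge> t0 \<longrightarrow> (da i has_integral (a i t - a i t0)) {t0..t})
    \<and> (\<forall>i. AE t in lebesgue. t \<ge> t0 \<longrightarrow>
          (\<forall>l. da i t $ l \<in> (\<lambda>x. - \<beta> * x) `
             SGN (((\<Sum>j\<in>{j. w i j > 0}. w i j *\<^sub>R (a i t - a j t)) + p i *\<^sub>R (a i t - a0 t)) $ l)))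
    \<and> (\<forall>i s t. ts s \<le> t \<and> t < ts (Suc s) \<longrightarrow>
          H i (q i t) *v ddq i t + C i (q i t) (dq i t) *v dq i t + g i (q i t) = tau i t
        \<and> tau i t = H i (q i t) *v
              (a i t
               - vmap \<phi> (sig ((\<Sum>j\<in>{j. w i j > 0}. w i j *\<^sub>R (q i t - q j t - F (\<sigma> s) i + F (\<sigma> s) j))
                               + p i *\<^sub>R (q i t - F (\<sigma> s) i - x0 t)) \<alpha>1)
               - vmap \<psi> (sig ((\<Sum>j\<in>{j. w i j > 0}. w i j *\<^sub>R (dq i t - dq j t))
                               + p i *\<^sub>R (dq i t - v0 t)) \<alpha>2))
            + C i (q i t) (dq i t) *v dq i t + g i (q i t)) )
    \<longrightarrow> (\<forall>s. \<exists>tf. ts s \<le> tf \<and> tf < ts (Suc s)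
          \<and> (\<forall>i j. ((\<lambda>t. norm (q i t - q j t - F (\<sigma> s) i + F (\<sigma> s) j)) \<longlongrightarrow> 0) (at tf within {t0..}))
          \<and> ((\<lambda>t. norm (inverse (real CARD('n)) *\<^sub>R (\<Sum>i\<in>UNIV. q i t) - x0 t)) \<longlongrightarrow> 0) (at tf within {t0..})
          \<and> (\<forall>i. ((\<lambda>t. norm (dq i t - v0 t)) \<longlongrightarrow> 0) (at tf within {t0..}))
          \<and> (\<forall>t. tf \<le> t \<and> t < ts (Suc s) \<longrightarrow>
                (\<forall>i j. norm (q i t - q j t - F (\<sigma> s) i + F (\<sigma> s) j) = 0)
              \<and> norm (inverse (real CARD('n)) *\<^sub>R (\<Sum>i\<in>UNIV. q i t) - x0 t) = 0
              \<and> (\<forall>i. norm (dq i t - v0 t) = 0)))"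
proof -
  interpret pinned_graph w p
    by unfold_locales (use w_sym w_nonneg p_nonneg A1 in auto)
  define f where "f y = \<phi> (\<bar>y\<bar> powr \<alpha>1 * sgn y)" for y
  define h where "h y = \<psi> (\<bar>y\<bar> powr \<alpha>2 * sgn y)" for y
  have a2: "\<alpha>2 > 0" using alpha1 by (simp add: alpha2)
  have f_power: "power_like f \<alpha>1" unfolding f_def using phi alpha1(1) by (rule power_like_admissible_sig)
  have h_power: "power_like h \<alpha>2" unfolding h_def using psi a2 by (rule power_like_admissible_sig)
  obtain \<Phi> where Phi: "\<Phi> 0 = 0" "\<And>y. (\<Phi> has_real_derivative f y) (at y)"
    using ex_antiderivative[of f] f_power unfolding power_like_def by blast
  interpret error_dynamics w p f h \<Phi> \<alpha>1
    by unfold_locales (use alpha1 f_power h_power[unfolded alpha2] Phi in auto)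
  obtain M where M: "M < \<beta>" "\<And>t. t \<ge> t0 \<Longrightarrow> norm (da0 t) \<le> M" using A2 by blast
  \<comment> \<open>A bound for every offset of every formation; the error jump at a switch is then
    at most 2 Fb per coordinate.\<close>
  define Fb where "Fb = (\<Sum>r\<le>k. \<Sum>i\<in>UNIV. norm (F r i))"
  have Fb: "norm (F r i) \<le> Fb" if "r \<le> k" for r i
  proof -
    have "norm (F r i) \<le> (\<Sum>i\<in>UNIV. norm (F r i))" by (rule member_le_sum) auto
    also have "\<dots> \<le> Fb" unfolding Fb_def
      using that by (intro member_le_sum[of r "{..k}" "\<lambda>r. \<Sum>i\<in>UNIV. norm (F r i)"]) (auto intro: sum_nonneg)
    finally show ?thesis .
  qed
  obtain T1 B where T1: "T1 \<ge> 0" and B: "B \<ge> 0" and estimator: "\<And>s a da r dr.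
     estimator_run \<beta> M s a da r dr \<Longrightarrow> (\<forall>i. \<bar>a i s - r s\<bar> \<le> R + norm (a0 t0)) \<Longrightarrow>
     (\<forall>i t. t \<ge> s \<longrightarrow> \<bar>a i t - r t\<bar> \<le> B) \<and> (\<forall>i t. t \<ge> s + T1 \<longrightarrow> a i t = r t)"
    using estimator_settling[OF beta_pos M(1), of "R + norm (a0 t0)"] by blast
  define K1 where "K1 = R + norm (x0 t0) + norm (v0 t0) + Fb"
  obtain K2 where K2: "\<And>s b e d. trajectory b s (s + T1) e d \<Longrightarrow>
     (\<forall>i t. s \<le> t \<and> t < s + T1 \<longrightarrow> \<bar>b i t\<bar> \<le> B) \<Longrightarrow>
     (\<forall>i. \<bar>e i s\<bar> \<le> K1 \<and> \<bar>d i s\<bar> \<le> K1) \<Longrightarrow> (\<forall>i. \<bar>e i (s + T1)\<bar> \<le> K2 \<and> \<bar>d i (s + T1)\<bar> \<le> K2)"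
    using perturbed_bounded[OF T1 B, of K1] by blast
  obtain T2 where T2: "T2 \<ge> 0" and settle2: "\<And>s u e d. trajectory (\<lambda>_ _. 0) s u e d \<Longrightarrow> s + T2 \<le> u \<Longrightarrow>
     (\<forall>i. \<bar>e i s\<bar> \<le> K2 \<and> \<bar>d i s\<bar> \<le> K2) \<Longrightarrow>
     (\<forall>t i. s + T2 \<le> t \<and> t \<le> u \<longrightarrow> e i t = 0 \<and> d i t = 0)"
    using finite_time_settling[of K2] by blast
  \<comment> \<open>Every later interval starts from settled motion under the previous formation, so
    its initial error is at most \<open>2 * Fb\<close>, whatever \<open>R\<close> was.\<close>
  obtain T3 where T3: "T3 \<ge> 0" and settle3: "\<And>s u e d. trajectory (\<lambda>_ _. 0) s u e d \<Longrightarrow> s + T3 \<le> u \<Longrightarrow>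
     (\<forall>i. \<bar>e i s\<bar> \<le> 2 * Fb \<and> \<bar>d i s\<bar> \<le> 2 * Fb) \<Longrightarrow>
     (\<forall>t i. s + T3 \<le> t \<and> t \<le> u \<longrightarrow> e i t = 0 \<and> d i t = 0)"
    using finite_time_settling[of "2 * Fb"] by blast
  \<comment> \<open>The same dwell time serves the first interval, which needs T1 + T2, and the
    later ones, which need T3. The 1 keeps the settling time strictly before the next
    switch.\<close>
  define T where "T = T1 + T2 + T3 + 1"
  have T: "T > 0" using T1 T2 T3 by (simp add: T_def)
  have Fb0: "Fb \<ge> 0" unfolding Fb_def by (intro sum_nonneg) auto
  show ?thesis
  proof (rule exI[of _ T], intro conjI T allI impI, elim conjE)
    fix ts :: "nat \<Rightarrow> real" and \<sigma> :: "nat \<Rightarrow> nat"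
      and q dq ddq a da tau :: "'n \<Rightarrow> real \<Rightarrow> real^'m" and s :: nat
    assume ts_mono: "strict_mono ts" and ts0: "ts 0 = t0" and dwell: "\<forall>s. ts (Suc s) - ts s \<ge> T"
      and sigma: "\<forall>s. \<sigma> s \<le> k"
      and init: "\<forall>i. norm (q i t0) \<le> R \<and> norm (dq i t0) \<le> R \<and> norm (a i t0) \<le> R"
      and q_der: "\<forall>i t. t \<ge> t0 \<longrightarrow> (q i has_vector_derivative dq i t) (at t within {t0..})"
      and dq_cont: "\<forall>i. continuous_on {t0..} (dq i)"
      and dq_der: "\<forall>i t. t \<ge> t0 \<longrightarrow> (dq i has_vector_derivative ddq i t) (at t within {t..})"
      and a_int: "\<forall>i t. t \<ge> t0 \<longrightarrow> (da i has_integral (a i t - a i t0)) {t0..t}"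
      and a_incl: "\<forall>i. AE t in lebesgue. t \<ge> t0 \<longrightarrow>
          (\<forall>l. da i t $ l \<in> (\<lambda>x. - \<beta> * x) `
             SGN (((\<Sum>j\<in>{j. w i j > 0}. w i j *\<^sub>R (a i t - a j t)) + p i *\<^sub>R (a i t - a0 t)) $ l))"
      and closed_loop: "\<forall>i s t. ts s \<le> t \<and> t < ts (Suc s) \<longrightarrow>
          H i (q i t) *v ddq i t + C i (q i t) (dq i t) *v dq i t + g i (q i t) = tau i t
        \<and> tau i t = H i (q i t) *v
              (a i t
               - vmap \<phi> (sig ((\<Sum>j\<in>{j. w i j > 0}. w i j *\<^sub>R (q i t - q j t - F (\<sigma> s) i + F (\<sigma> s) j))
                               + p i *\<^sub>R (q i t - F (\<sigma> s) i - x0 t)) \<alpha>1)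
               - vmap \<psi> (sig ((\<Sum>j\<in>{j. w i j > 0}. w i j *\<^sub>R (dq i t - dq j t))
                               + p i *\<^sub>R (dq i t - v0 t)) \<alpha>2))
            + C i (q i t) (dq i t) *v dq i t + g i (q i t)"
    define e where "e l s i t = q i t $ l - F (\<sigma> s) i $ l - x0 t $ l" for l s i t
    define d where "d l i t = dq i t $ l - v0 t $ l" for l i t
    define b where "b l i t = a i t $ l - a0 t $ l" for l i t
    \<comment> \<open>Non-neighbours have weight 0, so summing over neighbours amounts to summing
      over all nodes. The arguments of the controller and the estimator thus become grounded
      Laplacians of the errors, one coordinate at a time.\<close>
    have weighted: "((\<Sum>j\<in>{j. w i j > 0}. w i j *\<^sub>R (X i j)) + p i *\<^sub>R Y) $ l = lap w p x i"
      if "\<And>j. X i j $ l = x i - x j" "Y $ l = x i" for X :: "'n \<Rightarrow> 'n \<Rightarrow> real^'m" and Y x l i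
    proof -
      have "(\<Sum>j | 0 < w i j. w i j * (x i - x j)) = (\<Sum>j\<in>UNIV. w i j * (x i - x j))"
        by (rule sum.mono_neutral_left) (use w_nonneg[of i] in \<open>auto simp: not_less order.antisym\<close>)
      thus ?thesis using that by (simp add: lap_def)
    qed
    have F_component: "\<bar>F (\<sigma> s) i $ l\<bar> \<le> Fb" for s i l
      using component_le_norm_cart[of "F (\<sigma> s) i" l] Fb[of "\<sigma> s" i] sigma[THEN spec, of s] by linarith
    have ts_ge: "t0 \<le> ts s" for s using strict_mono_mono[OF ts_mono] ts0 by (metis le0 monoD)
    have ts_len: "ts s + T \<le> ts (Suc s)" for s using dwell[rule_format, of s] by linarith
    have ddq: "ddq i t $ l = a i t $ l - f (lap w p (\<lambda>j. e l s j t) i) - h (lap w p (\<lambda>j. d l j t) i)"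
      if t: "ts s \<le> t" "t < ts (Suc s)" for i s t l
    proof -
      define y where "y = (\<Sum>j\<in>{j. w i j > 0}. w i j *\<^sub>R (q i t - q j t - F (\<sigma> s) i + F (\<sigma> s) j))
                               + p i *\<^sub>R (q i t - F (\<sigma> s) i - x0 t)"
      define z where "z = (\<Sum>j\<in>{j. w i j > 0}. w i j *\<^sub>R (dq i t - dq j t)) + p i *\<^sub>R (dq i t - v0 t)"
      define u where "u = a i t - vmap \<phi> (sig y \<alpha>1) - vmap \<psi> (sig z \<alpha>2)"
      \<comment> \<open>The control cancels the Coriolis and gravity terms; positive definiteness
        makes \<open>H i (q i t)\<close> injective, which leaves a double integrator driven by
        \<open>u\<close>.\<close>
      have "H i (q i t) *v ddq i t = H i (q i t) *v u"
        using closed_loop[THEN spec[of _ i], THEN spec[of _ s], THEN spec[of _ t], THEN mp, OF conjI[OF t]]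
        unfolding u_def y_def z_def by auto
      hence "H i (q i t) *v (ddq i t - u) = 0" by (simp add: matrix_vector_mult_diff_distrib)
      hence "ddq i t - u = 0" using H_spd[of i "q i t"] by (metis inner_zero_right less_irrefl)
      hence "ddq i t = u" by simp
      moreover have "y $ l = lap w p (\<lambda>j. e l s j t) i"
        unfolding y_def by (rule weighted) (simp_all add: e_def)
      moreover have "z $ l = lap w p (\<lambda>j. d l j t) i"
        unfolding z_def by (rule weighted) (simp_all add: d_def)
      ultimately show ?thesis by (simp add: u_def vmap_def sig_def f_def h_def)
    qed
    have component: "((\<lambda>t. X t $ l) has_real_derivative X' $ l) (at t within S)"
      if "(X has_vector_derivative X') (at t within S)" for X :: "real \<Rightarrow> real^'m" and X' l t S
      using bounded_linear.has_vector_derivative[OF bounded_linear_vec_nth that]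
      by (simp add: has_real_derivative_iff_has_vector_derivative)
    have right: "((\<lambda>t. X t $ l) has_real_derivative X' $ l) (at t within {t..})"
      if "(X has_vector_derivative X') (at t within {t0..})" "t \<ge> t0" for X :: "real \<Rightarrow> real^'m" and X' l t
      by (rule component[OF has_vector_derivative_within_subset[OF that(1)]]) (use that(2) in auto)
    have cont: "continuous_on {t0..} (q i)" "continuous_on {t0..} x0" "continuous_on {t0..} v0" for i
      by (rule continuous_on_vector_derivative, use q_der leader_x leader_v in force)+
    have cont_e: "continuous_on {t0..} (e l s i)" and cont_d: "continuous_on {t0..} (d l i)" for l s i
      unfolding e_def d_def using dq_cont by (auto intro!: continuous_intros cont)
    have traj: "trajectory (b l) (ts s) (ts (Suc s)) (e l s) (d l)" for l s
      unfolding trajectory_def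
    proof (intro allI conjI impI)
      fix i
      show "continuous_on {ts s..ts (Suc s)} (e l s i)" "continuous_on {ts s..ts (Suc s)} (d l i)"
        using ts_ge[of s] by (auto intro: continuous_on_subset[OF cont_e] continuous_on_subset[OF cont_d])
      fix t assume t: "ts s \<le> t \<and> t < ts (Suc s)"
      hence t0: "t0 \<le> t" using ts_ge[of s] by simp
      show "(e l s i has_real_derivative d l i t) (at t within {t..})"
        unfolding e_def d_def using right[OF q_der[rule_format, OF t0] t0] right[OF leader_x[OF t0] t0]
        by (auto intro!: derivative_eq_intros)
      have "(d l i has_real_derivative ddq i t $ l - a0 t $ l) (at t within {t..})"
        unfolding d_def
        by (intro DERIV_diff component[OF dq_der[rule_format, OF t0]] right[OF leader_v[OF t0] t0])
      thus "(d l i has_real_derivative b l i t - f (lap w p (\<lambda>j. e l s j t) i) - h (lap w p (\<lambda>j. d l j t) i))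
          (at t within {t..})"
        using ddq[of s t i l] t by (simp add: b_def algebra_simps)
    qed
    \<comment> \<open>The estimator equation does not involve the formation, so a single run from
      \<open>t0\<close> covers all dwell intervals.\<close>
    have est: "(\<forall>i t. t \<ge> t0 \<longrightarrow> \<bar>b l i t\<bar> \<le> B) \<and> (\<forall>i t. t \<ge> t0 + T1 \<longrightarrow> b l i t = 0)" for l
    proof -
      have "(\<forall>i t. t \<ge> t0 \<longrightarrow> \<bar>a i t $ l - a0 t $ l\<bar> \<le> B) \<and> (\<forall>i t. t \<ge> t0 + T1 \<longrightarrow> a i t $ l = a0 t $ l)"
      proof (rule estimator[of t0 "\<lambda>i t. a i t $ l" "\<lambda>i t. da i t $ l" "\<lambda>t. a0 t $ l" "\<lambda>t. da0 t $ l"])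
        show "estimator_run \<beta> M t0 (\<lambda>i t. a i t $ l) (\<lambda>i t. da i t $ l) (\<lambda>t. a0 t $ l) (\<lambda>t. da0 t $ l)"
          unfolding estimator_run_def
        proof (intro conjI)
          show "\<forall>i t. t \<ge> t0 \<longrightarrow> ((\<lambda>t. da i t $ l) has_integral (a i t $ l - a i t0 $ l)) {t0..t}"
          proof (intro allI impI)
            fix i t assume "t \<ge> t0"
            hence "(da i has_integral (a i t - a i t0)) {t0..t}" using a_int by blast
            from has_integral_linear[OF this bounded_linear_vec_nth[of l]]
            show "((\<lambda>t. da i t $ l) has_integral (a i t $ l - a i t0 $ l)) {t0..t}" by (simp add: o_def)
          qed
          show "\<forall>i. AE t in lebesgue. t \<ge> t0 \<longrightarrow>
              da i t $ l \<in> (\<lambda>x. - \<beta> * x) ` SGN (lap w p (\<lambda>j. a j t $ l - a0 t $ l) i)"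
          proof
            fix i
            have eq: "((\<Sum>j\<in>{j. w i j > 0}. w i j *\<^sub>R (a i t - a j t)) + p i *\<^sub>R (a i t - a0 t)) $ l
                = lap w p (\<lambda>j. a j t $ l - a0 t $ l) i" for t
              by (rule weighted) simp_all
            show "AE t in lebesgue. t \<ge> t0 \<longrightarrow>
              da i t $ l \<in> (\<lambda>x. - \<beta> * x) ` SGN (lap w p (\<lambda>j. a j t $ l - a0 t $ l) i)"
              using a_incl[THEN spec, of i] by (rule AE_mp) (simp add: eq[symmetric])
          qed
          show "\<forall>t\<ge>t0. ((\<lambda>t. a0 t $ l) has_real_derivative da0 t $ l) (at t within {t0..}) \<and> \<bar>da0 t $ l\<bar> \<le> M"
          proof (intro allI impI conjI)
            fix t assume t: "t \<ge> t0"
            show "((\<lambda>t. a0 t $ l) has_real_derivative da0 t $ l) (at t within {t0..})"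
              by (rule component[OF leader_a[OF t]])
            show "\<bar>da0 t $ l\<bar> \<le> M" using component_le_norm_cart[of "da0 t" l] M(2)[OF t] by linarith
          qed
        qed
        show "\<forall>i. \<bar>a i t0 $ l - a0 t0 $ l\<bar> \<le> R + norm (a0 t0)"
        proof
          fix i
          show "\<bar>a i t0 $ l - a0 t0 $ l\<bar> \<le> R + norm (a0 t0)"
            using component_le_norm_cart[of "a i t0" l] component_le_norm_cart[of "a0 t0" l] init[rule_format, of i] by linarith
        qed
      qed
      thus ?thesis by (simp add: b_def)
    qed
    have unforced: "trajectory (\<lambda>_ _. 0) v (ts (Suc s)) (e l s) (d l)" if "ts s \<le> v" "t0 + T1 \<le> v" for l s v
      using trajectory_subinterval[OF traj[of l s] that(1) order_refl] est[of l] that(2)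
      unfolding trajectory_def by simp
    \<comment> \<open>Only the first interval has to wait for the estimator.\<close>
    define settle where "settle s = (if s = 0 then t0 + T1 + T2 else ts s + T3)" for s
    \<comment> \<open>The right end \<open>ts (Suc s)\<close> is included, still measured with the
      offsets of interval \<open>s\<close>; this supplies the initial state of the next
      interval.\<close>
    have settled: "\<forall>l i t. settle s \<le> t \<and> t \<le> ts (Suc s) \<longrightarrow> e l s i t = 0 \<and> d l i t = 0" for s
    proof (induction s)
      case 0
      show ?case
      proof (intro allI impI)
        fix l i t assume t: "settle 0 \<le> t \<and> t \<le> ts (Suc 0)"
        have len: "t0 + T1 + T2 \<le> ts (Suc 0)" using ts_len[of 0] T3 by (simp add: ts0 T_def)
        have tr: "trajectory (b l) t0 (t0 + T1) (e l 0) (d l)"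
          using trajectory_subinterval[OF traj[of l 0], of t0 "t0 + T1"] len T2 by (simp add: ts0)
        have "\<forall>i. \<bar>e l 0 i t0\<bar> \<le> K1 \<and> \<bar>d l i t0\<bar> \<le> K1"
        proof
          fix i
          have "\<bar>F (\<sigma> 0) i $ l\<bar> \<le> Fb" by (rule F_component)
          thus "\<bar>e l 0 i t0\<bar> \<le> K1 \<and> \<bar>d l i t0\<bar> \<le> K1"
            using component_le_norm_cart[of "q i t0" l] component_le_norm_cart[of "dq i t0" l]
              component_le_norm_cart[of "x0 t0" l] component_le_norm_cart[of "v0 t0" l]
              init[rule_format, of i] Fb0 norm_ge_zero[of "x0 t0"] norm_ge_zero[of "v0 t0"]
            unfolding e_def d_def K1_def by linarith
        qed
        hence start: "\<forall>i. \<bar>e l 0 i (t0 + T1)\<bar> \<le> K2 \<and> \<bar>d l i (t0 + T1)\<bar> \<le> K2"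
          using K2[OF tr] est[of l] by simp
        have "trajectory (\<lambda>_ _. 0) (t0 + T1) (ts (Suc 0)) (e l 0) (d l)"
          by (rule unforced) (use T1 ts0 in auto)
        from settle2[OF this len start] show "e l 0 i t = 0 \<and> d l i t = 0"
          using t by (simp add: settle_def)
      qed
    next
      case (Suc s)
      have s_le: "settle s \<le> ts (Suc s)"
        using ts_len[of s] T1 T2 T3 ts0 by (auto simp: settle_def T_def)
      show ?case
      proof (intro allI impI)
        fix l i t assume t: "settle (Suc s) \<le> t \<and> t \<le> ts (Suc (Suc s))"
        have len: "ts (Suc s) + T3 \<le> ts (Suc (Suc s))" using ts_len[of "Suc s"] T1 T2 by (simp add: T_def)
        have "\<forall>i. \<bar>e l (Suc s) i (ts (Suc s))\<bar> \<le> 2 * Fb \<and> \<bar>d l i (ts (Suc s))\<bar> \<le> 2 * Fb"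
        proof
          fix i
          \<comment> \<open>At the switch the velocity error is 0 and the new position error is just
            the difference of the old and the new offset.\<close>
          have "e l s i (ts (Suc s)) = 0" "d l i (ts (Suc s)) = 0" using Suc s_le by auto
          moreover have "\<bar>F (\<sigma> s) i $ l\<bar> \<le> Fb" "\<bar>F (\<sigma> (Suc s)) i $ l\<bar> \<le> Fb"
            by (rule F_component)+
          ultimately show "\<bar>e l (Suc s) i (ts (Suc s))\<bar> \<le> 2 * Fb \<and> \<bar>d l i (ts (Suc s))\<bar> \<le> 2 * Fb"
            using Fb0 unfolding e_def by auto
        qed
        moreover have "trajectory (\<lambda>_ _. 0) (ts (Suc s)) (ts (Suc (Suc s))) (e l (Suc s)) (d l)"
        proof (rule unforced)
          show "t0 + T1 \<le> ts (Suc s)" using ts_ge[of s] ts_len[of s] T2 T3 by (simp add: T_def)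
        qed simp
        ultimately show "e l (Suc s) i t = 0 \<and> d l i t = 0"
          using settle3[OF _ len] t by (simp add: settle_def)
      qed
    qed
    define tf where "tf = settle s"
    have tf: "ts s \<le> tf" "tf < ts (Suc s)"
      using ts_len[of s] T1 T2 T3 ts0 by (auto simp: tf_def settle_def T_def)
    have t0tf: "t0 \<le> tf" using tf ts_ge[of s] by simp
    have zero: "q i t = F (\<sigma> s) i + x0 t" "dq i t = v0 t" if "tf \<le> t" "t < ts (Suc s)" for i t
    proof -
      have "e l s i t = 0 \<and> d l i t = 0" for l using settled[of s] that by (simp add: tf_def)
      thus "q i t = F (\<sigma> s) i + x0 t" "dq i t = v0 t"
        unfolding e_def d_def vec_eq_iff by (auto simp: algebra_simps)
    qed
    have z1: "norm (q i t - q j t - F (\<sigma> s) i + F (\<sigma> s) j) = 0" if "tf \<le> t" "t < ts (Suc s)" for i j t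
      using zero[OF that] by simp
    have z2: "norm (inverse (real CARD('n)) *\<^sub>R (\<Sum>i\<in>UNIV. q i t) - x0 t) = 0" if "tf \<le> t" "t < ts (Suc s)" for t
    proof -
      \<comment> \<open>The offsets of a formation sum to 0, so exact formation tracking places the
        centroid on the leader.\<close>
      have "(\<Sum>i\<in>UNIV. q i t) = real CARD('n) *\<^sub>R x0 t"
        using formations[of "\<sigma> s"] sigma by (simp add: zero[OF that] sum.distrib sum_constant_scaleR del: sum_constant)
      thus ?thesis by simp
    qed
    have z3: "norm (dq i t - v0 t) = 0" if "tf \<le> t" "t < ts (Suc s)" for i t
      using zero[OF that] by simp
    \<comment> \<open>Positions and velocities are continuous across switches, so the limit at
      \<open>tf\<close> may be taken within all of \<open>{t0..}\<close>, even if \<open>tf\<close>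
      is itself a switching time.\<close>
    have limit: "(X \<longlongrightarrow> 0) (at tf within {t0..})" if "continuous_on {t0..} X" "X tf = 0" for X :: "real \<Rightarrow> real"
      using that t0tf by (metis atLeast_iff continuous_on_def)
    show "\<exists>tf. ts s \<le> tf \<and> tf < ts (Suc s)
          \<and> (\<forall>i j. ((\<lambda>t. norm (q i t - q j t - F (\<sigma> s) i + F (\<sigma> s) j)) \<longlongrightarrow> 0) (at tf within {t0..}))
          \<and> ((\<lambda>t. norm (inverse (real CARD('n)) *\<^sub>R (\<Sum>i\<in>UNIV. q i t) - x0 t)) \<longlongrightarrow> 0) (at tf within {t0..})
          \<and> (\<forall>i. ((\<lambda>t. norm (dq i t - v0 t)) \<longlongrightarrow> 0) (at tf within {t0..}))
          \<and> (\<forall>t. tf \<le> t \<and> t < ts (Suc s) \<longrightarrow>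
                (\<forall>i j. norm (q i t - q j t - F (\<sigma> s) i + F (\<sigma> s) j) = 0)
              \<and> norm (inverse (real CARD('n)) *\<^sub>R (\<Sum>i\<in>UNIV. q i t) - x0 t) = 0
              \<and> (\<forall>i. norm (dq i t - v0 t) = 0))"
    proof (intro exI[of _ tf] conjI allI impI tf)
      show "((\<lambda>t. norm (q i t - q j t - F (\<sigma> s) i + F (\<sigma> s) j)) \<longlongrightarrow> 0) (at tf within {t0..})" for i j
        using z1[OF order_refl tf(2)] by (intro limit continuous_intros cont) auto
      show "((\<lambda>t. norm (inverse (real CARD('n)) *\<^sub>R (\<Sum>i\<in>UNIV. q i t) - x0 t)) \<longlongrightarrow> 0) (at tf within {t0..})"
        using z2[OF order_refl tf(2)] by (intro limit continuous_intros cont) auto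
      show "((\<lambda>t. norm (dq i t - v0 t)) \<longlongrightarrow> 0) (at tf within {t0..})" for i
        using z3[OF order_refl tf(2)] dq_cont by (intro limit continuous_intros cont) auto
    qed (use z1 z2 z3 in auto)
  qed
qed

end
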